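(* Let $n=2k>3$ with $k\in\mathbb{N}$, let $\alpha\in(0,1]$, and let $\mathsf{s}_{\mathrm{pair}}=(s_1,\dots,s_n)$ with $s_{2i-1}=s_{2i}=\frac{2i-1}{2k}$ for $i\in\{1,\dots,k\}$. Assume the following hypothesis (a conjecture in the source): among all facilities $i$ and all unilateral deviations $s_i'\in[0,1]$ from $\mathsf{s}_{\mathrm{pair}}$, the highest improvement factor $u_i((\mathsf{s}_{\mathrm{pair}})_{-i},s_i')/u_i(\mathsf{s}_{\mathrm{pair}})$ is attained by one of the leftmost facilities $1$ or $2$ (which are co-located, hence equivalent; say facility $2$) changing her location towards the middle to her new interval border, i.e. to the location $s_2'$ that coincides with the right border $\beta_2$ of her own client interval in the client equilibrium after the move. Define the continued fractions $\hat K^{m}$ ($m$ an index, not an exponent) by $\hat K^{1}=-\alpha/4$ and $\hat K^{m}=\dfrac{-\alpha/4}{1+\hat K^{m-1}}$ for $m\ge 2$, and set $$\beta_1'=\frac{1}{1-\frac{\alpha}{2(\alpha+1+2\hat K^{n-3})}}\Bigg(\frac{1-\alpha}{2n}+\frac{1-\alpha}{2(\alpha+1)}\cdot\frac{1}{1+\frac{2}{\alpha+1}\hat K^{n-3}}\cdot\frac3n-\frac{2}{\alpha+1}\cdot\frac{1}{1+\frac{2}{\alpha+1}\hat K^{n-3}}\Bigg(\sum_{l=2}^{n/2-1}\Bigg(\frac{(-2)^{2l-3}}{\alpha^{l-1}}\cdot\frac{2(1-\alpha)l}{n}\prod_{j=n-2l}^{n-3}\hat K^{j}\Bigg)+\frac{(-2)^{n-4}}{2\alpha^{(n-4)/2}}\prod_{j=1}^{n-3}\hat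 K^{j}\Bigg)\Bigg),$$ $$\beta_2'=\frac{1}{1+\frac{2}{1+\alpha}\hat K^{n-3}}\Bigg(\frac{\alpha}{1+\alpha}\beta_1'+\frac{1-\alpha}{1+\alpha}\cdot\frac3n+\sum_{l=2}^{n/2-1}\Bigg(\frac{-4}{1+\alpha}\cdot\frac{(-2)^{2l-3}}{\alpha^{l-1}}\cdot\frac{2(1-\alpha)l}{n}\prod_{j=n-2l}^{n-3}\hat K^{j}\Bigg)-\frac{2}{1+\alpha}\cdot\frac{(-2)^{n-4}}{\alpha^{(n-4)/2}}\prod_{j=1}^{n-3}\hat K^{j}\Bigg).$$ Then the game with $n$ facilities and parameter $\alpha$ has a $\rho$-approximate pure subgame perfect equilibrium ($\rho$-SPE) with $\rho=n(\beta_2'-\beta_1')$.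
   Context: The game with parameters $n\ge 1$ and $\alpha\in[0,1]$: there are $n$ facility players $\{1,\dots,n\}$, each choosing a location $s_i\in[0,1]$; a facility location vector is $\mathsf{s}=(s_1,\dots,s_n)\in[0,1]^n$, and $(\mathsf{s}_{-i},s_i')$ is $\mathsf{s}$ with $s_i$ replaced by $s_i'$. The clients are the points $z\in[0,1]$. A client mapping is a function $\mathsf{f}:[0,1]^n\times[0,1]\to\{1,\dots,n\}$; client $z$ uses facility $\mathsf{f}(\mathsf{s},z)$. Only measurable mappings are considered: for every $\mathsf{s}$ and $i$, the set $\{z:\mathsf{f}(\mathsf{s},z)=i\}$ is a finite union of disjoint intervals; its total length is the load $\ell_i(\mathsf{s},\mathsf{f})$. The cost of client $z$ is $C_z(\mathsf{s},\mathsf{f})=(1-\alpha)|s_{\mathsf{f}(\mathsf{s},z)}-z|+\alpha\,\ell_{\mathsf{f}(\mathsf{s},z)}(\mathsf{s},\mathsf{f})$. The utility of facility $i$ is $u_i(\mathsf{s},\mathsf{f})=\ell_i(\mathsf{s},\mathsf{f})$. $\mathsf{f}(\mathsf{t},\cdot)$ is a client equilibrium if for all $z\in[0,1]$ and all $j$, $(1-\alpha)|t_{\mathsf{f}(\mathsf{t},z)}-z|+\alpha\ell_{\mathsf{f}(\mathsf{t},z)}(\mathsf{t},\mathsf{f})\le(1-\alpha)|t_j-z|+\alpha\ell_j(\mathsf{t},\mathsf{f})$. A pair $(\mathsf{s},\mathsf{f})$ is a $\rho$-SPE if (1) for all $i$ and all $s_i'\in[0,1]$, $\rho\cdot u_i(\mathsf{s},\mathsf{f})\ge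 u_i((\mathsf{s}_{-i},s_i'),\mathsf{f})$; and (2) $\mathsf{f}(\mathsf{t},\cdot)$ is a client equilibrium for every $\mathsf{t}\in[0,1]^n$. Induced client equilibrium: after renaming facilities so that $s_1\le\dots\le s_n$, a client equilibrium is proper if $[0,1]$ is partitioned (up to endpoints) into consecutive intervals $[\beta_{i-1},\beta_i]$, $\beta_0=0$, $\beta_n=1$, with facility $i$ serving $[\beta_{i-1},\beta_i]$. For $\alpha>0$ all client equilibria for a given $\mathsf{s}$ induce the same loads, and there is a unique proper one, in which the clients are assumed to be; its borders are the "interval borders", and $u_i(\mathsf{s})$ denotes the resulting utility. Empty sums are $0$. *)

theory Defs
  imports "HOL-Analysis.Analysis"
begin

text \<open>
  Location vectors for the players 1, ..., n are extensional functions, so that two of them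
  are equal as soon as they agree on the players; updating a vector at a player with a
  location in the unit interval yields a location vector again.
\<close>

definition loc_vectors :: "nat \<Rightarrow> (nat \<Rightarrow> real) set" where
  "loc_vectors n = {1..n} \<rightarrow>\<^sub>E {0..1}"

text \<open>
  A client assignment is what a client mapping prescribes for one fixed location vector.
  Degenerate intervals (single points, the empty set) are allowed.
\<close>

definition client_assignment :: "nat \<Rightarrow> (real \<Rightarrow> nat) \<Rightarrow> bool" where
  "client_assignment n g \<longleftrightarrow>
     (\<forall>z\<in>{0..1}. g z \<in> {1..n}) \<and>
     (\<forall>i\<in>{1..n}. \<exists>\<I>. finite \<I> \<and> disjoint \<I> \<and> (\<forall>I\<in>\<I>. is_interval I) \<and>
        {z \<in> {0..1}. g z = i} = \<Union>\<I>)"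

definition client_mapping :: "nat \<Rightarrow> ((nat \<Rightarrow> real) \<Rightarrow> real \<Rightarrow> nat) \<Rightarrow> bool" where
  "client_mapping n f \<longleftrightarrow> (\<forall>t\<in>loc_vectors n. client_assignment n (f t))"

definition load :: "(real \<Rightarrow> nat) \<Rightarrow> nat \<Rightarrow> real" where
  "load g i = measure lborel {z \<in> {0..1}. g z = i}"

definition utility :: "((nat \<Rightarrow> real) \<Rightarrow> real \<Rightarrow> nat) \<Rightarrow> (nat \<Rightarrow> real) \<Rightarrow> nat \<Rightarrow> real" where
  "utility f s i = load (f s) i"

text \<open>
  The loads on the right-hand side are those of the current assignment \<open>g\<close>: a single
  client has measure zero, so switching does not change any load.
\<close>

definition client_equilibrium :: "nat \<Rightarrow> real \<Rightarrow> (nat \<Rightarrow> real) \<Rightarrow> (real \<Rightarrow> nat) \<Rightarrow> bool" where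
  "client_equilibrium n \<alpha> t g \<longleftrightarrow>
     (\<forall>z\<in>{0..1}. \<forall>j\<in>{1..n}.
        (1 - \<alpha>) * \<bar>t (g z) - z\<bar> + \<alpha> * load g (g z) \<le> (1 - \<alpha>) * \<bar>t j - z\<bar> + \<alpha> * load g j)"

definition rho_SPE ::
    "nat \<Rightarrow> real \<Rightarrow> real \<Rightarrow> (nat \<Rightarrow> real) \<Rightarrow> ((nat \<Rightarrow> real) \<Rightarrow> real \<Rightarrow> nat) \<Rightarrow> bool" where
  "rho_SPE n \<alpha> \<rho> s f \<longleftrightarrow>
     s \<in> loc_vectors n \<and> client_mapping n f \<and>
     (\<forall>i\<in>{1..n}. \<forall>x\<in>{0..1}. \<rho> * utility f s i \<ge> utility f (s(i := x)) i) \<and>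
     (\<forall>t\<in>loc_vectors n. client_equilibrium n \<alpha> t (f t))"

text \<open>
  The permutation \<open>\<sigma>\<close> renames the facilities: \<open>\<sigma> i\<close> is the i-th facility from
  the left, ties being broken arbitrarily.  It serves the interval from \<open>\<beta> (i - 1)\<close> to
  \<open>\<beta> i\<close>; the clients at the borders themselves are only bound by the equilibrium condition.
\<close>

definition proper_client_equilibrium ::
    "nat \<Rightarrow> real \<Rightarrow> (nat \<Rightarrow> real) \<Rightarrow> (nat \<Rightarrow> nat) \<Rightarrow> (nat \<Rightarrow> real) \<Rightarrow> (real \<Rightarrow> nat) \<Rightarrow> bool" where
  "proper_client_equilibrium n \<alpha> s \<sigma> \<beta> g \<longleftrightarrow>
     \<sigma> permutes {1..n} \<and> (\<forall>i\<in>{1..<n}. s (\<sigma> i) \<le> s (\<sigma> (i + 1))) \<and>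
     \<beta> 0 = 0 \<and> \<beta> n = 1 \<and> (\<forall>i\<in>{1..n}. \<beta> (i - 1) \<le> \<beta> i) \<and>
     client_assignment n g \<and> client_equilibrium n \<alpha> s g \<and>
     (\<forall>i\<in>{1..n}. \<forall>z\<in>{\<beta> (i - 1)<..<\<beta> i}. g z = \<sigma> i)"

text \<open>
  Well defined for \<open>\<alpha> > 0\<close>, where all client equilibria for \<open>s\<close> have the same loads
  and a proper one exists.
\<close>

definition induced_utility :: "nat \<Rightarrow> real \<Rightarrow> (nat \<Rightarrow> real) \<Rightarrow> nat \<Rightarrow> real" where
  "induced_utility n \<alpha> s i =
     (THE u. \<exists>\<sigma> \<beta> g. proper_client_equilibrium n \<alpha> s \<sigma> \<beta> g \<and> u = load g i)"

text \<open>The superscript of the continued fractions starts at 1; the value at 0 is arbitrary.\<close>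

fun Khat :: "real \<Rightarrow> nat \<Rightarrow> real" where
  "Khat \<alpha> 0 = 0"
| "Khat \<alpha> (Suc 0) = - \<alpha> / 4"
| "Khat \<alpha> (Suc (Suc m)) = (- \<alpha> / 4) / (1 + Khat \<alpha> (Suc m))"

text \<open>
  For even \<open>n \<ge> 4\<close>, the only case of interest, none of the subtractions and divisions on
  natural numbers below truncates.
\<close>

definition beta1' :: "nat \<Rightarrow> real \<Rightarrow> real" where
  "beta1' n \<alpha> =
     1 / (1 - \<alpha> / (2 * (\<alpha> + 1 + 2 * Khat \<alpha> (n - 3)))) *
     ((1 - \<alpha>) / (2 * real n)
      + (1 - \<alpha>) / (2 * (\<alpha> + 1)) * (1 / (1 + 2 / (\<alpha> + 1) * Khat \<alpha> (n - 3))) * (3 / real n)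
      - 2 / (\<alpha> + 1) * (1 / (1 + 2 / (\<alpha> + 1) * Khat \<alpha> (n - 3))) *
        ((\<Sum>l = 2..n div 2 - 1.
            (-2) ^ (2 * l - 3) / \<alpha> ^ (l - 1) * (2 * (1 - \<alpha>) * real l / real n) *
            (\<Prod>j = n - 2 * l..n - 3. Khat \<alpha> j))
         + (-2) ^ (n - 4) / (2 * \<alpha> ^ ((n - 4) div 2)) * (\<Prod>j = 1..n - 3. Khat \<alpha> j)))"

definition beta2' :: "nat \<Rightarrow> real \<Rightarrow> real" where
  "beta2' n \<alpha> =
     1 / (1 + 2 / (1 + \<alpha>) * Khat \<alpha> (n - 3)) *
     (\<alpha> / (1 + \<alpha>) * beta1' n \<alpha>
      + (1 - \<alpha>) / (1 + \<alpha>) * (3 / real n)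
      + (\<Sum>l = 2..n div 2 - 1.
           - 4 / (1 + \<alpha>) * ((-2) ^ (2 * l - 3) / \<alpha> ^ (l - 1)) * (2 * (1 - \<alpha>) * real l / real n) *
           (\<Prod>j = n - 2 * l..n - 3. Khat \<alpha> j))
      - 2 / (1 + \<alpha>) * ((-2) ^ (n - 4) / \<alpha> ^ ((n - 4) div 2)) * (\<Prod>j = 1..n - 3. Khat \<alpha> j))"

end

theory Submission
  imports Defs
begin

text \<open>
  For fixed locations the loads of a client equilibrium are unique, and for a sorted location
  vector an equilibrium is given by borders at which the two neighbouring facilities are equally
  expensive. Mapping every location vector to such an equilibrium, the hypothesis bounds the
  improvement factor of every deviation from the paired locations by \<open>n\<close> times the load of
  facility 2 after her move to her own right border. A discrete maximum principle for the borders
  between consecutive pairs shows that after this move each border lies between the two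
  adjacent facilities (the case \<open>\<alpha> = 1\<close> being trivial), so that the absolute values can be
  resolved and the borders solve a tridiagonal linear system. Eliminating from the right end
  yields the continued fractions.
\<close>

section \<open>Existence and uniqueness of client equilibria\<close>

lemma client_assignment_sets:
  assumes "client_assignment n g" "i \<in> {1..n}"
  shows "{z \<in> {0..1}. g z = i} \<in> sets borel"
proof -
  obtain \<I> where "finite \<I>" "\<forall>I\<in>\<I>. is_interval I" "{z \<in> {0..1}. g z = i} = \<Union>\<I>"
    using assms unfolding client_assignment_def by meson
  then show ?thesis
    using real_interval_borel_measurable by (metis sets.finite_Union subsetI)
qed

lemma client_assignment_fmeasurable:
  assumes "client_assignment n g" "i \<in> {1..n}"
  shows "{z \<in> {0..1}. g z = i} \<in> fmeasurable lborel"
  by (rule fmeasurableI2[of "{0..1}"])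
     (use client_assignment_sets[OF assms] in \<open>auto intro!: fmeasurableI\<close>)

lemma sum_load:
  assumes g: "client_assignment n g" and A: "A \<subseteq> {1..n}"
  shows "(\<Sum>i\<in>A. load g i) = measure lborel {z \<in> {0..1}. g z \<in> A}"
proof -
  have "finite A" using A finite_subset by blast
  have "{z \<in> {0..1}. g z \<in> A} = (\<Union>i\<in>A. {z \<in> {0..1}. g z = i})" by auto
  also have "measure lborel \<dots> = (\<Sum>i\<in>A. measure lborel {z \<in> {0..1}. g z = i})"
    using client_assignment_fmeasurable[OF g] A
    by (intro measure_UNION' \<open>finite A\<close>) (auto simp: pairwise_def disjnt_def)
  finally show ?thesis by (simp add: load_def)
qed

text \<open>
  A client using a facility with increased load under \<open>g'\<close> also used one under \<open>g\<close>; so the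
  total load of these facilities cannot have increased.
\<close>

lemma equilibrium_load_le:
  assumes \<alpha>: "\<alpha> > 0"
    and g: "client_assignment n g" "client_equilibrium n \<alpha> t g"
    and g': "client_assignment n g'" "client_equilibrium n \<alpha> t g'"
    and i: "i \<in> {1..n}"
  shows "load g' i \<le> load g i"
proof (rule ccontr)
  define A where "A = {i \<in> {1..n}. load g i < load g' i}"
  assume "\<not> load g' i \<le> load g i"
  then have "i \<in> A" using i by (auto simp: A_def)
  have A: "A \<subseteq> {1..n}" "finite A" by (auto simp: A_def)
  have sub: "g z \<in> A" if z: "z \<in> {0..1}" "g' z \<in> A" for z
  proof (rule ccontr)
    assume "g z \<notin> A"
    have r: "g z \<in> {1..n}" "g' z \<in> {1..n}"
      using g g' z by (auto simp: client_assignment_def)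
    have "load g' (g z) \<le> load g (g z)" "load g (g' z) < load g' (g' z)"
      using \<open>g z \<notin> A\<close> z r by (auto simp: A_def)
    then have "\<alpha> * load g' (g z) \<le> \<alpha> * load g (g z)" "\<alpha> * load g (g' z) < \<alpha> * load g' (g' z)"
      using \<alpha> by auto
    moreover have "(1 - \<alpha>) * \<bar>t (g z) - z\<bar> + \<alpha> * load g (g z)
        \<le> (1 - \<alpha>) * \<bar>t (g' z) - z\<bar> + \<alpha> * load g (g' z)"
      using g(2) z r unfolding client_equilibrium_def by blast
    moreover have "(1 - \<alpha>) * \<bar>t (g' z) - z\<bar> + \<alpha> * load g' (g' z)
        \<le> (1 - \<alpha>) * \<bar>t (g z) - z\<bar> + \<alpha> * load g' (g z)"
      using g'(2) z r unfolding client_equilibrium_def by blast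
    ultimately show False by linarith
  qed
  have meas: "{z \<in> {0..1}. h z \<in> A} \<in> fmeasurable lborel" if "client_assignment n h" for h
  proof -
    have "{z \<in> {0..1}. h z \<in> A} = (\<Union>i\<in>A. {z \<in> {0..1}. h z = i})" by auto
    also have "\<dots> \<in> fmeasurable lborel"
      using A client_assignment_fmeasurable[OF that] by (intro fmeasurable.finite_UN) auto
    finally show ?thesis .
  qed
  have "(\<Sum>i\<in>A. load g' i) \<le> (\<Sum>i\<in>A. load g i)"
    unfolding sum_load[OF g(1) A(1)] sum_load[OF g'(1) A(1)]
    using meas[OF g(1)] fmeasurableD[OF meas[OF g'(1)]] sub by (intro measure_mono_fmeasurable) auto
  moreover have "(\<Sum>i\<in>A. load g i) < (\<Sum>i\<in>A. load g' i)"
    by (rule sum_strict_mono) (use A \<open>i \<in> A\<close> in \<open>auto simp: A_def\<close>)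
  ultimately show False by linarith
qed

lemma equilibrium_loads_unique:
  assumes "\<alpha> > 0"
    and "client_assignment n g" "client_equilibrium n \<alpha> t g"
    and "client_assignment n g'" "client_equilibrium n \<alpha> t g'"
    and "i \<in> {1..n}"
  shows "load g i = load g' i"
  using equilibrium_load_le assms by (meson order_antisym)

text \<open>
  Exchanging an adjacent inversion increases \<open>\<Sum>i. i * t (\<sigma> i)\<close>, so a maximizer sorts.
\<close>

lemma ex_sorting_permutation:
  fixes t :: "nat \<Rightarrow> real"
  shows "\<exists>\<sigma>. \<sigma> permutes {1..n} \<and> (\<forall>i\<in>{1..<n}. t (\<sigma> i) \<le> t (\<sigma> (i + 1)))"
proof -
  define F where "F \<sigma> = (\<Sum>i\<in>{1..n}. real i * t (\<sigma> i))" for \<sigma>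
  have fin: "finite {\<sigma>. \<sigma> permutes {1..n}}" by (simp add: finite_permutations)
  have ne: "{\<sigma>. \<sigma> permutes {1..n}} \<noteq> {}" using permutes_id by blast
  have "Max (F ` {\<sigma>. \<sigma> permutes {1..n}}) \<in> F ` {\<sigma>. \<sigma> permutes {1..n}}"
    using fin ne by (intro Max_in) blast+
  then obtain \<sigma> where \<sigma>: "\<sigma> permutes {1..n}" "F \<sigma> = Max (F ` {\<sigma>. \<sigma> permutes {1..n}})"
    by auto
  then have mx: "F \<tau> \<le> F \<sigma>" if "\<tau> permutes {1..n}" for \<tau>
    using fin that by simp
  have "t (\<sigma> i) \<le> t (\<sigma> (i + 1))" if i: "i \<in> {1..<n}" for i
  proof -
    define \<tau> where "\<tau> = \<sigma> \<circ> Transposition.transpose i (i + 1)"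
    have "\<tau> permutes {1..n}" unfolding \<tau>_def
      using i by (intro permutes_compose[OF _ \<sigma>(1)] permutes_swap_id) auto
    have split: "F \<rho> = real i * t (\<rho> i) + real (i + 1) * t (\<rho> (i + 1))
        + (\<Sum>j\<in>{1..n} - {i, i + 1}. real j * t (\<rho> j))" for \<rho>
    proof -
      have "F \<rho> = (\<Sum>j\<in>{i, i + 1}. real j * t (\<rho> j))
          + (\<Sum>j\<in>{1..n} - {i, i + 1}. real j * t (\<rho> j))"
        unfolding F_def using i by (subst sum.subset_diff[of "{i, i + 1}"]) auto
      then show ?thesis by simp
    qed
    have "(\<Sum>j\<in>{1..n} - {i, i + 1}. real j * t (\<tau> j)) = (\<Sum>j\<in>{1..n} - {i, i + 1}. real j * t (\<sigma> j))"
      by (intro sum.cong) (auto simp: \<tau>_def Transposition.transpose_def)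
    moreover have "\<tau> i = \<sigma> (i + 1)" "\<tau> (i + 1) = \<sigma> i" by (auto simp: \<tau>_def)
    ultimately show ?thesis
      using mx[OF \<open>\<tau> permutes {1..n}\<close>] split[of \<tau>] split[of \<sigma>] by (simp add: algebra_simps)
  qed
  then show ?thesis using \<sigma> by blast
qed

section \<open>Borders by a shooting argument\<close>

text \<open>Reduces equilibria for facilities at sorted locations \<open>L\<close> to finitely many
  equations: loads appear as interval lengths, and only the border clients are required to be
  indifferent between their two neighbours.\<close>

definition balanced_borders :: "nat \<Rightarrow> real \<Rightarrow> (nat \<Rightarrow> real) \<Rightarrow> (nat \<Rightarrow> real) \<Rightarrow> bool" where
  "balanced_borders n \<alpha> L \<beta> \<longleftrightarrow>
     \<beta> 0 = 0 \<and> \<beta> n = 1 \<and> (\<forall>i\<in>{1..n}. \<beta> (i - 1) \<le> \<beta> i) \<and>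
     (\<forall>i\<in>{1..<n}. (1 - \<alpha>) * \<bar>L i - \<beta> i\<bar> + \<alpha> * (\<beta> i - \<beta> (i - 1))
                 = (1 - \<alpha>) * \<bar>L (i + 1) - \<beta> i\<bar> + \<alpha> * (\<beta> (i + 1) - \<beta> i))"

text \<open>
  Indifference at the borders, with \<open>c = (1 - \<alpha>) / \<alpha>\<close>, determines all borders from the
  first one, \<open>b\<close>, which is then chosen by the intermediate value theorem such that the n-th
  border is 1. The borders need not be increasing for arbitrary \<open>b\<close>.
\<close>

fun shoot :: "real \<Rightarrow> (nat \<Rightarrow> real) \<Rightarrow> real \<Rightarrow> nat \<Rightarrow> real" where
  "shoot c L b 0 = 0"
| "shoot c L b (Suc 0) = b"
| "shoot c L b (Suc (Suc i)) = 2 * shoot c L b (Suc i) - shoot c L b i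
     + c * (\<bar>L (Suc i) - shoot c L b (Suc i)\<bar> - \<bar>L (Suc (Suc i)) - shoot c L b (Suc i)\<bar>)"

lemma continuous_shoot: "continuous_on A (\<lambda>b. shoot c L b i)"
  by (induction i rule: induct_nat_012) (auto intro!: continuous_intros)

text \<open>Started at 1, every border stays at or to the right of all facilities, so the correction
  term is nonnegative and the steps never become negative. This is the upper end for the
  intermediate value theorem.\<close>

lemma shoot_right:
  assumes c: "c \<ge> 0" and L: "\<And>i. i \<in> {1..n} \<Longrightarrow> L i \<in> {0..1}"
    and s: "\<And>i. i \<in> {1..<n} \<Longrightarrow> L i \<le> L (i + 1)"
    and i: "i \<in> {1..n}"
  shows "shoot c L 1 (i - 1) \<le> shoot c L 1 i \<and> 1 \<le> shoot c L 1 i"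
  using i
proof (induction i)
  case (Suc i)
  show ?case
  proof (cases i)
    case (Suc j)
    then have IH: "shoot c L 1 j \<le> shoot c L 1 i" "1 \<le> shoot c L 1 i"
      using Suc.IH Suc.prems by auto
    have "L i \<le> L (Suc i)" "L (Suc i) \<le> 1"
      using s[of i] L[of "Suc i"] Suc.prems Suc by auto
    then have "c * (\<bar>L i - shoot c L 1 i\<bar> - \<bar>L (Suc i) - shoot c L 1 i\<bar>) \<ge> 0"
      using IH c by auto
    then show ?thesis using IH Suc by auto
  qed auto
qed auto

text \<open>A solution with a decreasing step never reaches 1 at the n-th border.\<close>

lemma shoot_escapes:
  assumes c: "c \<ge> 0" and s: "\<And>i. i \<in> {1..<n} \<Longrightarrow> L i \<le> L (i + 1)"
    and m: "1 \<le> m" "m \<le> n"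
    and base: "shoot c L b m \<le> shoot c L b (m - 1)" "shoot c L b m < L m"
    and i: "m \<le> i" "i \<le> n"
  shows "shoot c L b i \<le> shoot c L b (i - 1) \<and> shoot c L b i < L i"
  using i
proof (induction i rule: dec_induct)
  case base
  show ?case using assms by auto
next
  case (step i)
  obtain j where j: "i = Suc j" using step m by (cases i) auto
  have IH: "shoot c L b i \<le> shoot c L b j" "shoot c L b i < L i" using step j by auto
  have "L i \<le> L (Suc i)" using s[of i] step m j by auto
  then have "c * (\<bar>L i - shoot c L b i\<bar> - \<bar>L (Suc i) - shoot c L b i\<bar>) \<le> 0"
    using IH c by (intro mult_nonneg_nonpos) auto
  then show ?case using IH j \<open>L i \<le> L (Suc i)\<close> by auto
qed

text \<open>Mirror image of \<open>shoot_right\<close>: started at 0, the borders stay at or to the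
  left of all facilities. This is the lower end for the intermediate value theorem.\<close>

lemma shoot_left:
  assumes c: "c \<ge> 0" and L: "\<And>i. i \<in> {1..n} \<Longrightarrow> L i \<in> {0..1}"
    and s: "\<And>i. i \<in> {1..<n} \<Longrightarrow> L i \<le> L (i + 1)"
    and i: "i \<in> {1..n}"
  shows "shoot c L 0 (i - 1) \<ge> shoot c L 0 i \<and> 0 \<ge> shoot c L 0 i"
  using i
proof (induction i)
  case (Suc i)
  show ?case
  proof (cases i)
    case (Suc j)
    then have IH: "shoot c L 0 j \<ge> shoot c L 0 i" "0 \<ge> shoot c L 0 i"
      using Suc.IH Suc.prems by auto
    have "L i \<le> L (Suc i)" "L i \<ge> 0"
      using s[of i] L[of i] Suc.prems Suc by auto
    then have "c * (\<bar>L i - shoot c L 0 i\<bar> - \<bar>L (Suc i) - shoot c L 0 i\<bar>) \<le> 0"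
      using IH c by (intro mult_nonneg_nonpos) auto
    then show ?thesis using IH Suc by auto
  qed auto
qed auto

lemma ex_balanced_borders:
  assumes n: "n \<ge> 1" and \<alpha>: "0 < \<alpha>" "\<alpha> \<le> 1"
    and L: "\<And>i. i \<in> {1..n} \<Longrightarrow> L i \<in> {0..1}"
    and s: "\<And>i. i \<in> {1..<n} \<Longrightarrow> L i \<le> L (i + 1)"
  shows "\<exists>\<beta>. balanced_borders n \<alpha> L \<beta>"
proof -
  define c where "c = (1 - \<alpha>) / \<alpha>"
  have c: "c \<ge> 0" "\<alpha> * c = 1 - \<alpha>" using \<alpha> by (auto simp: c_def)
  \<comment> \<open>The n-th value is at most 0 for the start 0 and at least 1 for the start
    1.\<close>
  have "\<exists>b\<ge>0. b \<le> 1 \<and> shoot c L b n = 1"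
    using shoot_left[of c n L n, OF c(1) L s] shoot_right[of c n L n, OF c(1) L s] n
    by (intro IVT' continuous_shoot) auto
  then obtain b where b: "b \<ge> 0" "shoot c L b n = 1" by blast
  define \<beta> where "\<beta> = shoot c L b"
  have mono: "\<beta> (i - 1) \<le> \<beta> i" if i: "i \<in> {1..n}" for i
  proof (rule ccontr)
    assume "\<not> \<beta> (i - 1) \<le> \<beta> i"
    then have lt: "\<beta> i < \<beta> (i - 1)" by simp
    \<comment> \<open>At the first decreasing step the correction term is negative, which puts the
      preceding border, and hence border \<open>m\<close>, left of \<open>L m\<close>. By
      \<open>shoot_escapes\<close> every later border \<open>i\<close> is left of
      \<open>L i\<close>, so the last one is below 1.\<close>
    have "\<exists>i. i \<in> {1..n} \<and> \<beta> i < \<beta> (i - 1)" using lt i by blast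
    then obtain m where m: "m \<in> {1..n}" "\<beta> m < \<beta> (m - 1)"
      and least: "\<And>j. j < m \<Longrightarrow> \<not> (j \<in> {1..n} \<and> \<beta> j < \<beta> (j - 1))"
      using exists_least_iff[of "\<lambda>i. i \<in> {1..n} \<and> \<beta> i < \<beta> (i - 1)"] by blast
    have "m \<noteq> 1" using m(2) b by (auto simp: \<beta>_def)
    then obtain j where j: "m = Suc (Suc j)"
      using m(1) by (metis One_nat_def atLeastAtMost_iff not0_implies_Suc not_one_le_zero)
    have "\<beta> j \<le> \<beta> (Suc j)" using least[of "Suc j"] m(1) j by auto
    moreover have "\<beta> m = 2 * \<beta> (Suc j) - \<beta> j + c * (\<bar>L (Suc j) - \<beta> (Suc j)\<bar> - \<bar>L m - \<beta> (Suc j)\<bar>)"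
      by (simp add: \<beta>_def j)
    ultimately have "c * (\<bar>L (Suc j) - \<beta> (Suc j)\<bar> - \<bar>L m - \<beta> (Suc j)\<bar>) < 0"
      using m(2) j by auto
    then have "\<bar>L (Suc j) - \<beta> (Suc j)\<bar> - \<bar>L m - \<beta> (Suc j)\<bar> < 0"
      using c(1) by (auto simp: mult_less_0_iff)
    moreover have "L (Suc j) \<le> L m" using s[of "Suc j"] j m(1) by auto
    ultimately have "\<beta> (Suc j) < L m" by linarith
    then have "\<beta> m < L m" using m(2) j by auto
    then have "\<beta> n < L n"
      using shoot_escapes[of c n L m b n, OF c(1) s] m by (auto simp: \<beta>_def)
    moreover have "L n \<le> 1" using L[of n] n by auto
    ultimately show False using b by (simp add: \<beta>_def)
  qed
  have bal: "(1 - \<alpha>) * \<bar>L i - \<beta> i\<bar> + \<alpha> * (\<beta> i - \<beta> (i - 1))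
      = (1 - \<alpha>) * \<bar>L (i + 1) - \<beta> i\<bar> + \<alpha> * (\<beta> (i + 1) - \<beta> i)" if i: "i \<in> {1..<n}" for i
  proof -
    obtain j where j: "i = Suc j" using i by (cases i) auto
    have "\<alpha> * (\<beta> (i + 1) - \<beta> i) = \<alpha> * (\<beta> i - \<beta> j) + (\<alpha> * c) * (\<bar>L i - \<beta> i\<bar> - \<bar>L (i + 1) - \<beta> i\<bar>)"
      by (simp add: \<beta>_def j algebra_simps)
    then show ?thesis using c by (simp add: j algebra_simps)
  qed
  show ?thesis
    unfolding balanced_borders_def using mono bal b by (intro exI[of _ \<beta>]) (auto simp: \<beta>_def)
qed

section \<open>From borders to proper equilibria\<close>

lemma borders_mono:
  fixes \<beta> :: "nat \<Rightarrow> real"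
  assumes "\<And>i. i \<in> {1..n} \<Longrightarrow> \<beta> (i - 1) \<le> \<beta> i" "i \<le> j" "j \<le> n"
  shows "\<beta> i \<le> \<beta> j"
  using assms(2,3)
proof (induction j rule: dec_induct)
  case (step m)
  then show ?case using assms(1)[of "Suc m"] by auto
qed auto

text \<open>Each load is at least the length of the corresponding interval, and both sum up to 1.\<close>

lemma load_eq_length:
  assumes \<sigma>: "\<sigma> permutes {1..n}"
    and \<beta>: "\<beta> 0 = 0" "\<beta> n = 1" "\<And>i. i \<in> {1..n} \<Longrightarrow> \<beta> (i - 1) \<le> \<beta> i"
    and g: "client_assignment n g"
    and inner: "\<And>i z. i \<in> {1..n} \<Longrightarrow> z \<in> {\<beta> (i - 1)<..<\<beta> i} \<Longrightarrow> g z = \<sigma> i"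
    and i: "i \<in> {1..n}"
  shows "load g (\<sigma> i) = \<beta> i - \<beta> (i - 1)"
proof -
  have le: "\<beta> i - \<beta> (i - 1) \<le> load g (\<sigma> i)" if i: "i \<in> {1..n}" for i
  proof -
    have "\<sigma> i \<in> {1..n}" using i permutes_in_image[OF \<sigma>] by blast
    have "0 \<le> \<beta> (i - 1)" "\<beta> i \<le> 1"
      using borders_mono[of n \<beta> 0 "i - 1", OF \<beta>(3)] borders_mono[of n \<beta> i n, OF \<beta>(3)] \<beta> i by auto
    then have "{\<beta> (i - 1)<..<\<beta> i} \<subseteq> {z \<in> {0..1}. g z = \<sigma> i}"
      using inner[OF i] by force
    then have "measure lborel {\<beta> (i - 1)<..<\<beta> i} \<le> load g (\<sigma> i)"
      unfolding load_def
      by (intro measure_mono_fmeasurable client_assignment_fmeasurable[OF g \<open>\<sigma> i \<in> {1..n}\<close>]) auto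
    then show ?thesis using \<beta>(3)[OF i] by simp
  qed
  have "{z \<in> {0..1}. g z \<in> {1..n}} = {0..1::real}"
    using g by (auto simp: client_assignment_def)
  then have "(\<Sum>i\<in>{1..n}. load g (\<sigma> i)) = 1"
    using sum_load[OF g subset_refl] by (subst sum.permute[OF \<sigma>, symmetric, unfolded comp_def]) simp
  moreover have "(\<Sum>i\<in>{1..n}. \<beta> i - \<beta> (i - 1)) = 1"
    using sum_telescope''[of 0 n \<beta>] \<beta> by (simp add: sum.atLeast_Suc_atMost)
  ultimately have "(\<Sum>i\<in>{1..n}. load g (\<sigma> i) - (\<beta> i - \<beta> (i - 1))) = 0"
    by (simp add: sum_subtractf)
  then have "\<forall>i\<in>{1..n}. load g (\<sigma> i) - (\<beta> i - \<beta> (i - 1)) = 0"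
    using le by (subst (asm) sum_nonneg_eq_0_iff) auto
  then show ?thesis using i by auto
qed

lemma proper_load:
  assumes "proper_client_equilibrium n \<alpha> t \<sigma> \<beta> g" "i \<in> {1..n}"
  shows "load g (\<sigma> i) = \<beta> i - \<beta> (i - 1)"
  using assms unfolding proper_client_equilibrium_def by (intro load_eq_length[of \<sigma> n \<beta> g]) auto

text \<open>The cost difference of two neighbouring facilities is nondecreasing in the client's
  position and vanishes at their common border. So each border separates the clients preferring the
  left neighbour from those preferring the right one, and these comparisons chain from
  \<open>i\<close> to \<open>j\<close>.\<close>

lemma balanced_cost_le:
  fixes \<alpha> :: real and L \<beta> :: "nat \<Rightarrow> real"
  defines "h \<equiv> \<lambda>i z. (1 - \<alpha>) * \<bar>L i - z\<bar> + \<alpha> * (\<beta> i - \<beta> (i - 1))"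
  assumes \<alpha>: "\<alpha> \<le> 1" and bal: "balanced_borders n \<alpha> L \<beta>"
    and s: "\<And>i. i \<in> {1..<n} \<Longrightarrow> L i \<le> L (i + 1)"
    and i: "i \<in> {1..n}" and j: "j \<in> {1..n}" and z: "\<beta> (i - 1) \<le> z" "z \<le> \<beta> i"
  shows "h i z \<le> h j z"
proof -
  have mono: "\<beta> (i - 1) \<le> \<beta> i" if "i \<in> {1..n}" for i
    using bal that by (auto simp: balanced_borders_def)
  have eq: "h i (\<beta> i) = h (i + 1) (\<beta> i)" if "i \<in> {1..<n}" for i
    using bal that by (auto simp: balanced_borders_def h_def)
  have diff: "h i x - h (i + 1) x \<le> h i y - h (i + 1) y" if "i \<in> {1..<n}" "x \<le> y" for i x y
  proof -
    have "\<bar>L i - x\<bar> - \<bar>L (i + 1) - x\<bar> \<le> \<bar>L i - y\<bar> - \<bar>L (i + 1) - y\<bar>"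
      using s[OF that(1)] that(2) by linarith
    then have "(1 - \<alpha>) * (\<bar>L i - x\<bar> - \<bar>L (i + 1) - x\<bar>) \<le> (1 - \<alpha>) * (\<bar>L i - y\<bar> - \<bar>L (i + 1) - y\<bar>)"
      using \<alpha> by (intro mult_left_mono) auto
    then show ?thesis by (simp add: h_def algebra_simps)
  qed
  show ?thesis
  proof (cases "i \<le> j")
    case True
    then show ?thesis using j
    proof (induction j rule: dec_induct)
      case (step m)
      then have m: "m \<in> {1..<n}" using i by auto
      have "z \<le> \<beta> m" using z borders_mono[of n \<beta> i m, OF mono] step m by auto
      then have "h m z \<le> h (Suc m) z" using eq[OF m] diff[OF m] by fastforce
      then show ?case using step m by auto
    qed auto
  next
    case False
    then have "j \<le> i" by simp
    then show ?thesis using j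
    proof (induction j rule: inc_induct)
      case (step m)
      then have m: "m \<in> {1..<n}" using i by auto
      have "m \<le> i - 1" "i - 1 \<le> n" using step i by auto
      then have "\<beta> m \<le> z"
        using z borders_mono[of n \<beta> m "i - 1", OF mono] step m i by auto
      then have "h (Suc m) z \<le> h m z" using eq[OF m] diff[OF m] by fastforce
      then show ?case using step m i by auto
    qed auto
  qed
qed

text \<open>A border client goes to the left one of the two facilities. The condition
  \<open>1 \<le> i\<close> keeps index 0, whose border is 0, from capturing the client at 0.\<close>

definition interval_assignment :: "(nat \<Rightarrow> nat) \<Rightarrow> (nat \<Rightarrow> real) \<Rightarrow> real \<Rightarrow> nat" where
  "interval_assignment \<sigma> \<beta> z = \<sigma> (LEAST i. 1 \<le> i \<and> z \<le> \<beta> i)"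

lemma interval_assignment_eq:
  fixes n :: nat
  assumes "\<And>i. i \<in> {1..n} \<Longrightarrow> \<beta> (i - 1) \<le> \<beta> i"
    and "i \<in> {1..n}" "z \<le> \<beta> i" "i = 1 \<or> \<beta> (i - 1) < z"
  shows "interval_assignment \<sigma> \<beta> z = \<sigma> i"
proof -
  have "(LEAST i. 1 \<le> i \<and> z \<le> \<beta> i) = i"
  proof (rule Least_equality)
    fix j assume j: "1 \<le> j \<and> z \<le> \<beta> j"
    show "i \<le> j"
    proof (rule ccontr)
      assume "\<not> i \<le> j"
      then have "j \<le> i - 1" "i - 1 \<le> n" "i \<noteq> 1" using j assms(2) by auto
      then show False using borders_mono[of n \<beta> j "i - 1", OF assms(1)] assms j by auto
    qed
  qed (use assms in auto)
  then show ?thesis by (simp add: interval_assignment_def)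
qed

lemma ex_border_interval:
  fixes n :: nat and \<beta> :: "nat \<Rightarrow> real"
  assumes "z \<le> \<beta> n" "n \<ge> 1"
  shows "\<exists>i\<in>{1..n}. z \<le> \<beta> i \<and> (i = 1 \<or> \<beta> (i - 1) < z)"
proof -
  define P where "P i \<longleftrightarrow> 1 \<le> i \<and> z \<le> \<beta> i" for i
  have "P n" using assms by (simp add: P_def)
  then obtain i where i: "P i" "\<forall>j<i. \<not> P j" using exists_least_iff[of P] by blast
  then have "i \<le> n" using \<open>P n\<close> not_le_imp_less by blast
  moreover have "i = 1 \<or> \<beta> (i - 1) < z"
    using i(1) i(2)[rule_format, of "i - 1"] by (cases "i = 1") (auto simp: P_def)
  ultimately show ?thesis using i(1) by (intro bexI[of _ i]) (auto simp: P_def)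
qed

text \<open>The interval lengths are the loads by \<open>load_eq_length\<close>, so
  \<open>balanced_cost_le\<close> for the sorted locations \<open>t \<circ> \<sigma>\<close> becomes
  the equilibrium condition.\<close>

lemma proper_interval_assignment:
  assumes n: "n \<ge> 1" and \<alpha>: "\<alpha> \<le> 1" and \<sigma>: "\<sigma> permutes {1..n}"
    and s: "\<And>i. i \<in> {1..<n} \<Longrightarrow> t (\<sigma> i) \<le> t (\<sigma> (i + 1))"
    and bal: "balanced_borders n \<alpha> (t \<circ> \<sigma>) \<beta>"
  shows "proper_client_equilibrium n \<alpha> t \<sigma> \<beta> (interval_assignment \<sigma> \<beta>)"
proof -
  define g where "g = interval_assignment \<sigma> \<beta>"
  have \<beta>: "\<beta> 0 = 0" "\<beta> n = 1" "\<And>i. i \<in> {1..n} \<Longrightarrow> \<beta> (i - 1) \<le> \<beta> i"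
    using bal by (auto simp: balanced_borders_def)
  have eq: "g z = \<sigma> i" if "i \<in> {1..n}" "z \<le> \<beta> i" "i = 1 \<or> \<beta> (i - 1) < z" for i z
    unfolding g_def using interval_assignment_eq[of n \<beta> i z \<sigma>, OF \<beta>(3)] that by blast
  have ex: "\<exists>i\<in>{1..n}. z \<le> \<beta> i \<and> (i = 1 \<or> \<beta> (i - 1) < z)" if "z \<in> {0..1}" for z
    using ex_border_interval[of z \<beta> n] that \<beta> n by auto
  have inj: "\<sigma> i = \<sigma> j \<Longrightarrow> i = j" for i j using permutes_inj[OF \<sigma>] by (auto dest: injD)
  have asg: "client_assignment n g"
    unfolding client_assignment_def
  proof (intro conjI ballI)
    fix z :: real assume "z \<in> {0..1}"
    then show "g z \<in> {1..n}" using ex eq \<sigma> permutes_in_image by metis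
  next
    fix j assume j: "j \<in> {1..n}"
    define i where "i = inv \<sigma> j"
    have i: "i \<in> {1..n}" "\<sigma> i = j"
      using j \<sigma> permutes_in_image[OF permutes_inv[OF \<sigma>]] permutes_inverses[OF \<sigma>] by (auto simp: i_def)
    have "{z \<in> {0..1}. g z = j} = {z \<in> {0..1}. z \<le> \<beta> i \<and> (i = 1 \<or> \<beta> (i - 1) < z)}"
      using ex eq i inj by (intro Collect_cong conj_cong refl) metis
    moreover have "is_interval \<dots>" by (auto simp: is_interval_1)
    ultimately show "\<exists>\<I>. finite \<I> \<and> disjoint \<I> \<and> (\<forall>I\<in>\<I>. is_interval I) \<and> {z \<in> {0..1}. g z = j} = \<Union>\<I>"
      by (intro exI[of _ "{{z \<in> {0..1}. g z = j}}"]) (auto simp: pairwise_def)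
  qed
  have inner: "g z = \<sigma> i" if "i \<in> {1..n}" "z \<in> {\<beta> (i - 1)<..<\<beta> i}" for i z
    using eq[of i z] that by auto
  have ld: "load g (\<sigma> i) = \<beta> i - \<beta> (i - 1)" if "i \<in> {1..n}" for i
    using load_eq_length[OF \<sigma> \<beta> asg inner that] .
  have "client_equilibrium n \<alpha> t g"
    unfolding client_equilibrium_def
  proof (intro ballI)
    fix z :: real and j assume z: "z \<in> {0..1}" and j: "j \<in> {1..n}"
    obtain i where i: "i \<in> {1..n}" "z \<le> \<beta> i" "i = 1 \<or> \<beta> (i - 1) < z" using ex[OF z] by blast
    define m where "m = inv \<sigma> j"
    have m: "m \<in> {1..n}" "\<sigma> m = j"
      using j \<sigma> permutes_in_image[OF permutes_inv[OF \<sigma>]] permutes_inverses[OF \<sigma>] by (auto simp: m_def)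
    have "\<beta> (i - 1) \<le> z" using i z \<beta>(1) by auto
    then have "(1 - \<alpha>) * \<bar>(t \<circ> \<sigma>) i - z\<bar> + \<alpha> * (\<beta> i - \<beta> (i - 1))
        \<le> (1 - \<alpha>) * \<bar>(t \<circ> \<sigma>) m - z\<bar> + \<alpha> * (\<beta> m - \<beta> (m - 1))"
      using s i m by (intro balanced_cost_le[OF \<alpha> bal]) auto
    then show "(1 - \<alpha>) * \<bar>t (g z) - z\<bar> + \<alpha> * load g (g z) \<le> (1 - \<alpha>) * \<bar>t j - z\<bar> + \<alpha> * load g j"
      using eq[OF i] ld[OF i(1)] ld[OF m(1)] m(2) by simp
  qed
  then show ?thesis
    unfolding proper_client_equilibrium_def g_def[symmetric]
    using \<sigma> s \<beta> asg inner by blast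
qed

lemma ex_proper_client_equilibrium:
  assumes n: "n \<ge> 1" and \<alpha>: "0 < \<alpha>" "\<alpha> \<le> 1" and t: "t \<in> loc_vectors n"
  shows "\<exists>\<sigma> \<beta> g. proper_client_equilibrium n \<alpha> t \<sigma> \<beta> g"
proof -
  obtain \<sigma> where \<sigma>: "\<sigma> permutes {1..n}" "\<forall>i\<in>{1..<n}. t (\<sigma> i) \<le> t (\<sigma> (i + 1))"
    using ex_sorting_permutation by blast
  have "(t \<circ> \<sigma>) i \<in> {0..1}" if "i \<in> {1..n}" for i
    using t that permutes_in_image[OF \<sigma>(1)] by (auto simp: loc_vectors_def PiE_iff)
  then obtain \<beta> where "balanced_borders n \<alpha> (t \<circ> \<sigma>) \<beta>"
    using ex_balanced_borders[OF n \<alpha>, of "t \<circ> \<sigma>"] \<sigma> by auto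
  then show ?thesis using proper_interval_assignment[OF n \<alpha>(2) \<sigma>(1)] \<sigma>(2) by blast
qed

text \<open>Uniqueness of the loads lets the definite description be evaluated at any proper
  equilibrium.\<close>

lemma induced_utility_eq:
  assumes \<alpha>: "\<alpha> > 0" and i: "i \<in> {1..n}" and p: "proper_client_equilibrium n \<alpha> t \<sigma> \<beta> g"
  shows "induced_utility n \<alpha> t i = load g i"
  unfolding induced_utility_def
proof (rule the_equality)
  show "\<exists>\<sigma> \<beta> g'. proper_client_equilibrium n \<alpha> t \<sigma> \<beta> g' \<and> load g i = load g' i"
    using p by blast
  fix u assume "\<exists>\<sigma> \<beta> g. proper_client_equilibrium n \<alpha> t \<sigma> \<beta> g \<and> u = load g i"
  then show "u = load g i"
    using equilibrium_loads_unique[OF \<alpha> _ _ _ _ i] p unfolding proper_client_equilibrium_def by blast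
qed

text \<open>Sorted locations allow the identity as renaming, so utilities are read off from the
  borders.\<close>

lemma induced_utility_balanced:
  assumes n: "n \<ge> 1" and \<alpha>: "0 < \<alpha>" "\<alpha> \<le> 1"
    and s: "\<And>i. i \<in> {1..<n} \<Longrightarrow> t i \<le> t (i + 1)"
    and bal: "balanced_borders n \<alpha> t \<beta>" and i: "i \<in> {1..n}"
  shows "induced_utility n \<alpha> t i = \<beta> i - \<beta> (i - 1)"
proof -
  have p: "proper_client_equilibrium n \<alpha> t id \<beta> (interval_assignment id \<beta>)"
    using proper_interval_assignment[OF n \<alpha>(2) permutes_id] s bal by auto
  show ?thesis using induced_utility_eq[OF \<alpha>(1) i p] proper_load[OF p i] by simp
qed

section \<open>Elimination of the borders\<close>

text \<open>The lower bound reproduces itself: it gives \<open>1 + K \<ge> 1 / 2\<close>, and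
  \<open>\<alpha> / 4\<close> divided by that is at most \<open>\<alpha> / 2\<close>. It keeps all
  denominators of the elimination away from 0.\<close>

lemma Khat_bounds:
  assumes "0 < \<alpha>" "\<alpha> \<le> 1"
  shows "- \<alpha> / 2 \<le> Khat \<alpha> m \<and> Khat \<alpha> m \<le> 0"
proof (induction m rule: induct_nat_012)
  case (ge2 m)
  define K where "K = Khat \<alpha> (Suc m)"
  have K: "1 / 2 \<le> 1 + K" using ge2 assms by (simp add: K_def)
  then have "\<alpha> / 4 / (1 + K) \<le> \<alpha> / 4 / (1 / 2)"
    using assms by (intro divide_left_mono) auto
  moreover have "0 \<le> \<alpha> / 4 / (1 + K)" using K assms by auto
  ultimately show ?case by (simp add: K_def[symmetric])
qed (use assms in auto)

lemma Khat_rec: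
  assumes "0 < \<alpha>" "\<alpha> \<le> 1" "m \<ge> 1"
  shows "Khat \<alpha> (Suc m) * (1 + Khat \<alpha> m) = - \<alpha> / 4"
proof -
  have "1 + Khat \<alpha> m \<noteq> 0" using Khat_bounds[OF assms(1,2), of m] assms by auto
  moreover have "Khat \<alpha> (Suc m) = (- \<alpha> / 4) / (1 + Khat \<alpha> m)" using assms(3) by (cases m) auto
  ultimately show ?thesis by (metis nonzero_eq_divide_eq)
qed

text \<open>The factor accumulated in front of the remainder once the elimination has reached border
  \<open>2 * r\<close>. For \<open>n \<ge> 4\<close> it is 1 at \<open>r = 1\<close>, the product
  being empty.\<close>

definition elim_coeff :: "nat \<Rightarrow> real \<Rightarrow> nat \<Rightarrow> real" where
  "elim_coeff n \<alpha> r = (-2) ^ (2 * r - 2) / \<alpha> ^ (r - 1) * (\<Prod>j = n - 2 * r..n - 3. Khat \<alpha> j)"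

lemma elim_coeff_Suc:
  assumes "\<alpha> \<noteq> 0" "1 \<le> r" "2 * Suc r < n"
  shows "elim_coeff n \<alpha> (Suc r)
    = 4 / \<alpha> * Khat \<alpha> (n - 2 * r - 2) * Khat \<alpha> (n - 2 * r - 1) * elim_coeff n \<alpha> r"
proof -
  obtain q where q: "r = Suc q" using assms by (cases r) auto
  define m where "m = n - 2 * r - 2"
  have m: "n - 2 * Suc r = m" "n - 2 * r = Suc (Suc m)" "n - 2 * r - 1 = Suc m" "Suc m \<le> n - 3"
    using assms by (auto simp: m_def)
  have "(\<Prod>j = m..n - 3. Khat \<alpha> j)
      = Khat \<alpha> m * (Khat \<alpha> (Suc m) * (\<Prod>j = Suc (Suc m)..n - 3. Khat \<alpha> j))"
    using m(4) by (simp add: prod.atLeast_Suc_atMost)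
  then show ?thesis
    using assms(1) unfolding elim_coeff_def m m_def[symmetric] by (simp add: q field_simps)
qed

text \<open>
  Gaussian elimination from the right end: \<open>Khat\<close> and \<open>elim_coeff\<close> come from
  substituting \<open>\<beta> m = p m * \<beta> (m - 1) + q m\<close> into the equation for \<open>\<beta> (m - 1)\<close>,
  where \<open>p m\<close> is \<open>- 2 / \<alpha> * Khat \<alpha> (n - m)\<close> for odd \<open>m\<close> and
  \<open>- 2 * Khat \<alpha> (n - m)\<close> for even \<open>m\<close>.
\<close>

lemma tridiagonal_elimination:
  fixes n k :: nat and \<alpha> :: real and \<beta> :: "nat \<Rightarrow> real"
  assumes \<alpha>: "0 < \<alpha>" "\<alpha> \<le> 1" and n: "n = 2 * k" "k \<ge> 2"
    and odd: "\<And>l. l \<in> {1..<k} \<Longrightarrow> \<beta> (2 * l + 1) = (\<beta> (2 * l) + \<beta> (2 * l + 2)) / 2"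
    and even: "\<And>l. l \<in> {2..<k} \<Longrightarrow>
      \<beta> (2 * l) = (1 - \<alpha>) * (2 * real l / real n) + \<alpha> / 2 * (\<beta> (2 * l - 1) + \<beta> (2 * l + 1))"
    and r: "r \<in> {1..<k}"
  shows "\<alpha> * \<beta> 3 + 2 * Khat \<alpha> (n - 3) * \<beta> 2
    = (\<Sum>l = 2..r. 4 * (1 - \<alpha>) * real l / real n * elim_coeff n \<alpha> l)
      + elim_coeff n \<alpha> r * (\<alpha> * \<beta> (2 * r + 1) + 2 * Khat \<alpha> (n - 2 * r - 1) * \<beta> (2 * r))"
proof -
  have "1 \<le> r" using r by auto
  then show ?thesis using r
  proof (induction r rule: dec_induct)
    case base
    have "{n - 2..n - 3} = {}" using n by auto
    then show ?case by (simp add: elim_coeff_def numeral_3_eq_3)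
  next
    case (step r)
    define s where "s = n - 2 * r - 3"
    have s: "n - 2 * r - 2 = Suc s" "n - 2 * r - 1 = Suc (Suc s)" "n - 2 * Suc r - 1 = s" "s \<ge> 1"
      using step n by (auto simp: s_def)
    define u v w where "u = Khat \<alpha> s" and "v = Khat \<alpha> (Suc s)" and "w = Khat \<alpha> (Suc (Suc s))"
    have K: "v * (1 + u) = - \<alpha> / 4" "w * (1 + v) = - \<alpha> / 4"
      unfolding u_def v_def w_def by (rule Khat_rec[OF \<alpha>], use s(4) in simp)+
    define a b c d where "a = \<beta> (2 * r)" and "b = \<beta> (2 * r + 1)" and "c = \<beta> (2 * r + 2)"
      and "d = \<beta> (2 * r + 3)"
    define e where "e = (1 - \<alpha>) * (2 * real (Suc r) / real n)"
    have ob: "b = (a + c) / 2" using odd[of r] step by (simp add: a_def b_def c_def)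
    have ev: "c = e + \<alpha> / 2 * (b + d)"
      using even[of "Suc r"] step by (simp add: b_def c_def d_def e_def eval_nat_numeral)
    \<comment> \<open>Rewrites the remainder at \<open>2 * r\<close> as a multiple of the same
      expression at \<open>2 * r + 2\<close> plus an inhomogeneous term: the equation for
      \<open>c\<close> removes \<open>d\<close>, and the two recursions in \<open>K\<close> then
      absorb \<open>u\<close> and the product \<open>w * v\<close>.\<close>
    have pivot: "\<alpha> * b + 2 * w * a = 4 / \<alpha> * v * w * (2 * e + (\<alpha> * d + 2 * u * c))"
    proof -
      have "\<alpha> * d = 2 * c - 2 * e - \<alpha> * b" using ev by (simp add: field_simps)
      then have "4 * v * w * (2 * e + (\<alpha> * d + 2 * u * c)) = 4 * w * (2 * (v * (1 + u)) * c - \<alpha> * b * v)"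
        by algebra
      also have "\<dots> = 4 * w * (- \<alpha> / 2 * c - \<alpha> * b * v)" using K(1) by simp
      also have "\<dots> = - 4 * \<alpha> * (w * c / 2 + b * (w * v))" by algebra
      also have "w * v = - \<alpha> / 4 - w" using K(2) by (simp add: algebra_simps)
      also have "- 4 * \<alpha> * (w * c / 2 + b * (- \<alpha> / 4 - w)) = \<alpha> * (\<alpha> * b + 2 * w * a)"
        unfolding ob by (simp add: field_simps)
      finally show ?thesis using \<alpha> by (simp add: field_simps)
    qed
    have coeff: "elim_coeff n \<alpha> (Suc r) = 4 / \<alpha> * v * w * elim_coeff n \<alpha> r"
      using elim_coeff_Suc[of \<alpha> r n] step \<alpha> n s by (simp add: v_def w_def)
    have "\<alpha> * \<beta> 3 + 2 * Khat \<alpha> (n - 3) * \<beta> 2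
      = (\<Sum>l = 2..r. 4 * (1 - \<alpha>) * real l / real n * elim_coeff n \<alpha> l)
        + elim_coeff n \<alpha> r * (\<alpha> * b + 2 * w * a)"
      using step s by (simp add: a_def b_def w_def)
    also have "elim_coeff n \<alpha> r * (\<alpha> * b + 2 * w * a)
      = 2 * e * elim_coeff n \<alpha> (Suc r) + elim_coeff n \<alpha> (Suc r) * (\<alpha> * d + 2 * u * c)"
      unfolding pivot coeff by (simp only: distrib_left mult_ac)
    finally have "\<alpha> * \<beta> 3 + 2 * Khat \<alpha> (n - 3) * \<beta> 2
      = (\<Sum>l = 2..r. 4 * (1 - \<alpha>) * real l / real n * elim_coeff n \<alpha> l)
        + 2 * e * elim_coeff n \<alpha> (Suc r) + elim_coeff n \<alpha> (Suc r) * (\<alpha> * d + 2 * u * c)"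
      by (simp only: add.assoc)
    moreover have "(\<Sum>l = 2..Suc r. 4 * (1 - \<alpha>) * real l / real n * elim_coeff n \<alpha> l)
      = (\<Sum>l = 2..r. 4 * (1 - \<alpha>) * real l / real n * elim_coeff n \<alpha> l)
        + 2 * e * elim_coeff n \<alpha> (Suc r)"
      using step by (simp add: e_def algebra_simps)
    moreover have "\<beta> (2 * Suc r + 1) = d" "\<beta> (2 * Suc r) = c"
      by (simp_all add: c_def d_def eval_nat_numeral)
    ultimately show ?case
      unfolding s(3) u_def[symmetric] by (simp only:)
  qed
qed

text \<open>Elimination up to the last pair expresses \<open>\<beta> 3\<close> by
  \<open>\<beta> 2\<close>. With the equations \<open>one\<close> and \<open>two\<close> this leaves
  a 2 by 2 system for \<open>\<beta> 1\<close> and \<open>\<beta> 2\<close>, whose solution is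
  matched with the closed forms.\<close>

lemma border_system_solution:
  fixes n k :: nat and \<alpha> :: real and \<beta> :: "nat \<Rightarrow> real"
  assumes \<alpha>: "0 < \<alpha>" "\<alpha> \<le> 1" and n: "n = 2 * k" "k \<ge> 2"
    and one: "\<beta> 1 = (1 - \<alpha>) / (2 * real n) + \<beta> 2 / 2"
    and two: "(1 + \<alpha>) * \<beta> 2 = \<alpha> * \<beta> 1 + (1 - \<alpha>) * (3 / real n) + \<alpha> * \<beta> 3"
    and odd: "\<And>l. l \<in> {1..<k} \<Longrightarrow> \<beta> (2 * l + 1) = (\<beta> (2 * l) + \<beta> (2 * l + 2)) / 2"
    and even: "\<And>l. l \<in> {2..<k} \<Longrightarrow>
      \<beta> (2 * l) = (1 - \<alpha>) * (2 * real l / real n) + \<alpha> / 2 * (\<beta> (2 * l - 1) + \<beta> (2 * l + 1))"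
    and last: "\<beta> n = 1"
  shows "\<beta> 1 = beta1' n \<alpha>" "\<beta> 2 = beta2' n \<alpha>"
proof -
  define K where "K = Khat \<alpha> (n - 3)"
  define S where "S = (\<Sum>l = 2..n div 2 - 1.
            (-2) ^ (2 * l - 3) / \<alpha> ^ (l - 1) * (2 * (1 - \<alpha>) * real l / real n) *
            (\<Prod>j = n - 2 * l..n - 3. Khat \<alpha> j))"
  define T where "T = (-2) ^ (n - 4) / \<alpha> ^ ((n - 4) div 2) * (\<Prod>j = 1..n - 3. Khat \<alpha> j)"
  have K: "- \<alpha> / 2 \<le> K" using Khat_bounds[OF \<alpha>] by (simp add: K_def)
  \<comment> \<open>The factor \<open>- 4\<close> comes from \<open>4 * l = 2 * (2 * l)\<close> and
    the one additional power of \<open>-2\<close> in \<open>elim_coeff\<close>.\<close>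
  have sum: "(\<Sum>l = 2..k - 1. 4 * (1 - \<alpha>) * real l / real n * elim_coeff n \<alpha> l) = - 4 * S"
    unfolding S_def sum_distrib_left
  proof (intro sum.cong)
    fix l assume "l \<in> {2..n div 2 - 1}"
    then have "2 * l - 2 = Suc (2 * l - 3)" by auto
    then show "4 * (1 - \<alpha>) * real l / real n * elim_coeff n \<alpha> l
      = - 4 * ((-2) ^ (2 * l - 3) / \<alpha> ^ (l - 1) * (2 * (1 - \<alpha>) * real l / real n) *
            (\<Prod>j = n - 2 * l..n - 3. Khat \<alpha> j))"
      unfolding elim_coeff_def using \<alpha> n by (simp add: field_simps)
  qed (use n in auto)
  \<comment> \<open>The product in \<open>T\<close> starts at 1, that in \<open>elim_coeff\<close>
    at 2; the missing factor is \<open>Khat \<alpha> 1 = - \<alpha> / 4\<close>.\<close>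
  have last_term: "elim_coeff n \<alpha> (k - 1) * \<alpha> / 2 = - 2 * T"
  proof -
    obtain q where q: "k = Suc (Suc q)" using n by (metis add_2_eq_Suc le_Suc_ex)
    define X P where "X = (-2) ^ (n - 4) / \<alpha> ^ ((n - 4) div 2)" and "P = (\<Prod>j = 2..n - 3. Khat \<alpha> j)"
    have "(\<Prod>j = 1..n - 3. Khat \<alpha> j) = - \<alpha> / 4 * P"
      unfolding P_def using n by (simp add: prod.atLeast_Suc_atMost eval_nat_numeral)
    then have "T = X * (- \<alpha> / 4 * P)" by (simp add: T_def X_def)
    moreover have "elim_coeff n \<alpha> (k - 1) = X * P"
      by (simp add: elim_coeff_def X_def P_def n q)
    ultimately show ?thesis by simp
  qed
  \<comment> \<open>At the last pair the continued fraction is \<open>- \<alpha> / 4\<close>, and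
    border \<open>n - 1\<close> is the midpoint of border \<open>n - 2\<close> and 1; so
    \<open>\<beta> (n - 2)\<close> cancels.\<close>
  have pen: "\<alpha> * \<beta> (2 * (k - 1) + 1) + 2 * Khat \<alpha> (n - 2 * (k - 1) - 1) * \<beta> (2 * (k - 1)) = \<alpha> / 2"
  proof -
    have i: "n - 2 * (k - 1) - 1 = Suc 0" "2 * (k - 1) + 2 = n" using n by auto
    show ?thesis using odd[of "k - 1"] n last unfolding i by (simp add: field_simps)
  qed
  have "\<alpha> * \<beta> 3 + 2 * K * \<beta> 2 = - 4 * S - 2 * T"
    using tridiagonal_elimination[OF \<alpha> n odd even, of "k - 1"] n sum last_term
    unfolding pen K_def by simp
  then have b2: "(1 + \<alpha> + 2 * K) * \<beta> 2 = \<alpha> * \<beta> 1 + (1 - \<alpha>) * (3 / real n) - 4 * S - 2 * T"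
    using two by (simp add: algebra_simps)
  \<comment> \<open>The coefficient of \<open>\<beta> 2\<close>; the bound
    \<open>- \<alpha> / 2 \<le> K\<close> makes it at least 1. Below, \<open>E\<close> is what
    remains as coefficient of \<open>\<beta> 1\<close> after inserting \<open>\<beta> 2\<close> into
    the equation \<open>one\<close>.\<close>
  define D where "D = 1 + \<alpha> + 2 * K"
  have D: "D \<ge> 1" using K by (simp add: D_def)
  define R where "R = (1 - \<alpha>) * (3 / real n) - 4 * S - 2 * T"
  have b2D: "\<beta> 2 = (\<alpha> * \<beta> 1 + R) / D" using b2 D by (simp add: D_def R_def field_simps)
  have f: "1 / (1 + 2 / (1 + \<alpha>) * K) = (1 + \<alpha>) / D"
    using \<alpha> D by (simp add: D_def field_simps)
  have DD: "2 * D - \<alpha> > 0" using D \<alpha> by simp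
  define E where "E = 1 - \<alpha> / (2 * D)"
  have "E \<noteq> 0" using D DD by (simp add: E_def field_simps)
  moreover have "\<beta> 1 * E = (1 - \<alpha>) / (2 * real n) + R / (2 * D)"
  proof -
    have "\<beta> 1 = (1 - \<alpha>) / (2 * real n) + (\<alpha> * \<beta> 1 / (2 * D) + R / (2 * D))"
      using one b2D D by (simp add: add_divide_distrib)
    then show ?thesis by (simp add: E_def right_diff_distrib mult.commute)
  qed
  ultimately have b1D: "\<beta> 1 = 1 / (1 - \<alpha> / (2 * D)) * ((1 - \<alpha>) / (2 * real n) + R / (2 * D))"
    unfolding E_def[symmetric] by (metis nonzero_eq_divide_eq mult.commute times_divide_eq_right mult.right_neutral)
  have half_T: "(-2) ^ (n - 4) / (2 * \<alpha> ^ ((n - 4) div 2)) * (\<Prod>j = 1..n - 3. Khat \<alpha> j) = T / 2"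
    by (simp add: T_def)
  have "beta1' n \<alpha> = 1 / (1 - \<alpha> / (2 * D)) * ((1 - \<alpha>) / (2 * real n)
      + (1 - \<alpha>) / (2 * (1 + \<alpha>)) * ((1 + \<alpha>) / D) * (3 / real n)
      - 2 / (1 + \<alpha>) * ((1 + \<alpha>) / D) * (S + T / 2))"
    unfolding beta1'_def K_def[symmetric] S_def[symmetric] half_T add.commute[of \<alpha> 1] f
      D_def[symmetric] ..
  also have "\<dots> = 1 / (1 - \<alpha> / (2 * D)) * ((1 - \<alpha>) / (2 * real n) + R / (2 * D))"
  proof -
    have "(1 - \<alpha>) / (2 * (1 + \<alpha>)) * ((1 + \<alpha>) / D) * (3 / real n)
      - 2 / (1 + \<alpha>) * ((1 + \<alpha>) / D) * (S + T / 2) = R / (2 * D)"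
    proof -
      have cancel: "x / (c * p) * (p / D) = x / (c * D)" if "p \<noteq> 0" for x c p
        using that by simp
      have q: "(1 - \<alpha>) / (2 * (1 + \<alpha>)) * ((1 + \<alpha>) / D) = (1 - \<alpha>) / (2 * D)"
        "2 / (1 + \<alpha>) * ((1 + \<alpha>) / D) = 2 / D"
        using cancel[of "1 + \<alpha>" "1 - \<alpha>" 2] cancel[of "1 + \<alpha>" 2 1] \<alpha> by simp_all
      show ?thesis unfolding q using D by (simp add: R_def add_divide_distrib diff_divide_distrib algebra_simps)
    qed
    then show ?thesis by (simp add: algebra_simps)
  qed
  finally show one': "\<beta> 1 = beta1' n \<alpha>" using b1D by simp
  have "(\<Sum>l = 2..n div 2 - 1.
           - 4 / (1 + \<alpha>) * ((-2) ^ (2 * l - 3) / \<alpha> ^ (l - 1)) * (2 * (1 - \<alpha>) * real l / real n) *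
           (\<Prod>j = n - 2 * l..n - 3. Khat \<alpha> j)) = - 4 / (1 + \<alpha>) * S"
    unfolding S_def sum_distrib_left by (simp add: mult.assoc)
  then have "beta2' n \<alpha> = (1 + \<alpha>) / D * (\<alpha> / (1 + \<alpha>) * \<beta> 1 + (1 - \<alpha>) / (1 + \<alpha>) * (3 / real n)
      + - 4 / (1 + \<alpha>) * S - 2 / (1 + \<alpha>) * T)"
    unfolding beta2'_def f[symmetric] K_def[symmetric] T_def one' by (simp add: mult.assoc)
  also have "\<dots> = (\<alpha> * \<beta> 1 + R) / D"
  proof -
    have cancel: "(1 + \<alpha>) * (x / (1 + \<alpha>) * y) = x * y" for x y
      using \<alpha> by simp
    have "(1 + \<alpha>) * (\<alpha> / (1 + \<alpha>) * \<beta> 1 + (1 - \<alpha>) / (1 + \<alpha>) * (3 / real n)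
      + - 4 / (1 + \<alpha>) * S - 2 / (1 + \<alpha>) * T) = \<alpha> * \<beta> 1 + R"
      unfolding distrib_left right_diff_distrib cancel by (simp add: R_def right_diff_distrib)
    then show ?thesis by (metis times_divide_eq_left)
  qed
  finally show "\<beta> 2 = beta2' n \<alpha>" using b2D by simp
qed

section \<open>The deviation from the paired locations\<close>

text \<open>The distance costs of co-located facilities cancel, so they share their joint interval
  equally.\<close>

lemma balanced_coincident:
  assumes "balanced_borders n \<alpha> L \<beta>" "\<alpha> > 0" "i \<in> {1..<n}" "L i = L (i + 1)"
  shows "\<beta> i = (\<beta> (i - 1) + \<beta> (i + 1)) / 2"
proof -
  have "\<alpha> * (\<beta> i - \<beta> (i - 1)) = \<alpha> * (\<beta> (i + 1) - \<beta> i)"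
    using assms unfolding balanced_borders_def by force
  then have "\<beta> i - \<beta> (i - 1) = \<beta> (i + 1) - \<beta> i" using assms(2) by simp
  then show ?thesis by simp
qed

text \<open>A border between its two facilities fixes the signs of both distances, which makes the
  indifference linear; for \<open>\<alpha> = 1\<close> the distances have weight 0.\<close>

lemma balanced_inside:
  assumes "balanced_borders n \<alpha> L \<beta>" "i \<in> {1..<n}" "\<alpha> = 1 \<or> L i \<le> \<beta> i \<and> \<beta> i \<le> L (i + 1)"
  shows "2 * \<beta> i = (1 - \<alpha>) * (L i + L (i + 1)) + \<alpha> * (\<beta> (i - 1) + \<beta> (i + 1))"
proof -
  have "(1 - \<alpha>) * \<bar>L i - \<beta> i\<bar> + \<alpha> * (\<beta> i - \<beta> (i - 1))
      = (1 - \<alpha>) * \<bar>L (i + 1) - \<beta> i\<bar> + \<alpha> * (\<beta> (i + 1) - \<beta> i)"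
    using assms unfolding balanced_borders_def by blast
  moreover have "(1 - \<alpha>) * \<bar>L i - \<beta> i\<bar> = (1 - \<alpha>) * (\<beta> i - L i)"
    "(1 - \<alpha>) * \<bar>L (i + 1) - \<beta> i\<bar> = (1 - \<alpha>) * (L (i + 1) - \<beta> i)"
    using assms(3) by auto
  ultimately show ?thesis by (simp add: algebra_simps)
qed

section \<open>Position of the borders after the deviation\<close>

lemma ex_argmax_nat:
  fixes d :: "nat \<Rightarrow> real"
  assumes "a \<le> b"
  shows "\<exists>m\<in>{a..b}. \<forall>l\<in>{a..b}. d l \<le> d m"
proof -
  have "Max (d ` {a..b}) \<in> d ` {a..b}" using assms by (intro Max_in) auto
  then obtain m where "m \<in> {a..b}" "d m = Max (d ` {a..b})" by auto
  then show ?thesis by (intro bexI[of _ m]) auto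
qed

text \<open>A maximum above \<open>c\<close> would be attained at an interior index, where the
  increments go from nonnegative to nonpositive, against strict convexity there.\<close>

lemma discrete_maximum_principle:
  fixes d :: "nat \<Rightarrow> real"
  assumes "\<And>l. l \<in> {a<..<b} \<Longrightarrow> d l > c \<Longrightarrow> d l - d (l - 1) < d (l + 1) - d l"
    and "d a \<le> c" "d b \<le> c" "l \<in> {a..b}"
  shows "d l \<le> c"
proof (rule ccontr)
  assume "\<not> d l \<le> c"
  obtain m where m: "m \<in> {a..b}" "\<forall>l\<in>{a..b}. d l \<le> d m"
    using ex_argmax_nat[of a b d] assms(4) by auto
  have "d m > c" using m(2) assms(4) \<open>\<not> d l \<le> c\<close> by force
  then have "m \<noteq> a" "m \<noteq> b" using assms by auto
  then have "m \<in> {a<..<b}" "m - 1 \<in> {a..b}" "m + 1 \<in> {a..b}" using m(1) by auto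
  then have "d m - d (m - 1) < d (m + 1) - d m" "d (m - 1) \<le> d m" "d (m + 1) \<le> d m"
    using assms(1) \<open>d m > c\<close> m(2) by auto
  then show False by linarith
qed

text \<open>The situation after facility 2 has moved right to her own right border
  \<open>\<beta> 2\<close>, not passing the next pair at \<open>3 / n\<close>; all other facilities
  keep their places.\<close>

locale pair_deviation =
  fixes n k :: nat and \<alpha> :: real and L \<beta> :: "nat \<Rightarrow> real"
  assumes \<alpha>: "0 < \<alpha>" "\<alpha> \<le> 1" and n: "n = 2 * k" "k \<ge> 2"
    and L1: "L 1 = 1 / real n" and L2: "L 2 = \<beta> 2" "1 / real n < L 2" "L 2 \<le> 3 / real n"
    and L_odd: "\<And>l. l \<in> {1..<k} \<Longrightarrow> L (2 * l + 1) = (2 * real l + 1) / real n"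
    and L_even: "\<And>l. l \<in> {2..k} \<Longrightarrow> L (2 * l) = (2 * real l - 1) / real n"
    and bal: "balanced_borders n \<alpha> L \<beta>"
begin

lemma n_pos: "real n > 0" using n by simp

lemma inverse_n_pos: "1 / real n > 0" using n_pos by simp

text \<open>The borders of the pairs, measured relative to their positions before the deviation.\<close>

definition d :: "nat \<Rightarrow> real" where "d l = \<beta> (2 * l) - 2 * real l / real n"

lemma d_last: "d k = 0"
proof -
  have "\<beta> n = 1" using bal by (simp add: balanced_borders_def)
  then show ?thesis unfolding d_def using n by simp
qed

lemma odd_border: "l \<in> {1..<k} \<Longrightarrow> \<beta> (2 * l + 1) = (\<beta> (2 * l) + \<beta> (2 * l + 2)) / 2"
  using balanced_coincident[OF bal \<alpha>(1), of "2 * l + 1"] L_odd[of l] L_even[of "Suc l"] n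
  by (simp add: add_ac)

text \<open>Only the right neighbour is resolved, since for \<open>l = 1\<close> the left one is the
  deviating facility. An odd border is the midpoint of two pair borders, so its interval length is
  half a difference of \<open>d\<close> plus \<open>1 / n\<close>.\<close>

lemma border_balance:
  assumes "l \<in> {1..<k}"
  shows "(1 - \<alpha>) * \<bar>L (2 * l) - \<beta> (2 * l)\<bar> + \<alpha> * (\<beta> (2 * l) - \<beta> (2 * l - 1))
    = (1 - \<alpha>) * \<bar>(2 * real l + 1) / real n - \<beta> (2 * l)\<bar> + \<alpha> * (d (l + 1) - d l) / 2 + \<alpha> / real n"
proof -
  have "\<alpha> * (\<beta> (2 * l + 1) - \<beta> (2 * l)) = \<alpha> * (d (l + 1) - d l) / 2 + \<alpha> / real n"
    using odd_border[OF assms] n_pos by (simp add: d_def field_simps)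
  moreover have "(1 - \<alpha>) * \<bar>L (2 * l) - \<beta> (2 * l)\<bar> + \<alpha> * (\<beta> (2 * l) - \<beta> (2 * l - 1))
      = (1 - \<alpha>) * \<bar>L (2 * l + 1) - \<beta> (2 * l)\<bar> + \<alpha> * (\<beta> (2 * l + 1) - \<beta> (2 * l))"
    using bal assms n unfolding balanced_borders_def by force
  ultimately show ?thesis using L_odd[OF assms] by simp
qed

text \<open>With intact pairs on both sides, the imbalance of distances at a pair border is, up to
  positive weights, the second difference of \<open>d\<close>. Hence that difference has the sign of
  \<open>d l\<close> when \<open>\<alpha> < 1\<close>, as \<open>d_convex\<close> and
  \<open>d_concave\<close> state.\<close>

lemma d_balance:
  assumes "l \<in> {1<..<k}"
  shows "2 * (1 - \<alpha>) * (\<bar>d l + 1 / real n\<bar> - \<bar>1 / real n - d l\<bar>)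
    = \<alpha> * ((d (l + 1) - d l) - (d l - d (l - 1)))"
proof -
  obtain m where m: "l = Suc m" "m \<in> {1..<k}" using assms by (cases l) auto
  have "\<alpha> * (\<beta> (2 * l) - \<beta> (2 * l - 1)) = \<alpha> * (d l - d (l - 1)) / 2 + \<alpha> / real n"
    using odd_border[OF m(2)] n_pos m by (simp add: d_def field_simps)
  moreover have "\<bar>L (2 * l) - \<beta> (2 * l)\<bar> = \<bar>d l + 1 / real n\<bar>"
    "\<bar>(2 * real l + 1) / real n - \<beta> (2 * l)\<bar> = \<bar>1 / real n - d l\<bar>"
    using L_even[of l] assms by (simp_all add: d_def diff_divide_distrib add_divide_distrib)
  ultimately show ?thesis
    using border_balance[of l] assms by (simp add: algebra_simps diff_divide_distrib)
qed

lemma d_convex: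
  assumes "\<alpha> < 1" "l \<in> {1<..<k}" "d l > 0"
  shows "d l - d (l - 1) < d (l + 1) - d l"
proof -
  have "\<bar>d l + 1 / real n\<bar> - \<bar>1 / real n - d l\<bar> > 0"
    using assms(3) inverse_n_pos by linarith
  then have "0 < 2 * (1 - \<alpha>) * (\<bar>d l + 1 / real n\<bar> - \<bar>1 / real n - d l\<bar>)"
    using assms by simp
  also have "\<dots> = \<alpha> * ((d (l + 1) - d l) - (d l - d (l - 1)))"
    by (rule d_balance[OF assms(2)])
  finally show ?thesis using \<alpha>(1) by (simp add: zero_less_mult_iff)
qed

lemma d_concave:
  assumes "\<alpha> < 1" "l \<in> {1<..<k}" "d l < 0"
  shows "d (l + 1) - d l < d l - d (l - 1)"
proof -
  have "\<bar>1 / real n - d l\<bar> - \<bar>d l + 1 / real n\<bar> > 0"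
    using assms(3) inverse_n_pos by linarith
  then have "0 < 2 * (1 - \<alpha>) * (\<bar>1 / real n - d l\<bar> - \<bar>d l + 1 / real n\<bar>)"
    using assms by simp
  also have "\<dots> = \<alpha> * ((d l - d (l - 1)) - (d (l + 1) - d l))"
    using d_balance[OF assms(2)] by (simp add: algebra_simps)
  finally show ?thesis using \<alpha>(1) by (simp add: zero_less_mult_iff)
qed

lemma d_one: "d 1 = \<beta> 2 - 2 / real n" "- 1 / real n \<le> d 1" "d 1 \<le> 1 / real n"
proof -
  show d1: "d 1 = \<beta> 2 - 2 / real n" by (simp add: d_def numeral_2_eq_2)
  show "- 1 / real n \<le> d 1" "d 1 \<le> 1 / real n"
    unfolding d1 using L2 n_pos by (simp_all add: field_simps)
qed

text \<open>The maximum principle for \<open>d\<close> and for \<open>- d\<close>, with boundary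
  values from \<open>d_one\<close> and \<open>d_last\<close>. It says that every pair border from
  the second pair on lies between its neighbouring pairs.\<close>

lemma abs_d_le:
  assumes "\<alpha> < 1" "l \<in> {1..k}"
  shows "\<bar>d l\<bar> \<le> 1 / real n"
proof -
  have "d l \<le> 1 / real n"
  proof (rule discrete_maximum_principle)
    show "d l - d (l - 1) < d (l + 1) - d l" if "l \<in> {1<..<k}" "1 / real n < d l" for l
      using d_convex[OF assms(1) that(1)] that(2) inverse_n_pos by linarith
  qed (use d_one d_last inverse_n_pos assms in auto)
  moreover have "- d l \<le> 1 / real n"
  proof (rule discrete_maximum_principle)
    show "- d l - - d (l - 1) < - d (l + 1) - - d l" if "l \<in> {1<..<k}" "1 / real n < - d l" for l
      using d_concave[OF assms(1) that(1)] that(2) inverse_n_pos by linarith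
  qed (use d_one d_last inverse_n_pos assms in auto)
  ultimately show ?thesis by linarith
qed

lemma first_balance:
  "(1 - \<alpha>) * \<bar>1 / real n - \<beta> 1\<bar> + \<alpha> * \<beta> 1 = (1 - \<alpha>) * \<bar>\<beta> 2 - \<beta> 1\<bar> + \<alpha> * (\<beta> 2 - \<beta> 1)"
proof -
  have "(1 - \<alpha>) * \<bar>L 1 - \<beta> 1\<bar> + \<alpha> * (\<beta> 1 - \<beta> (1 - 1)) = (1 - \<alpha>) * \<bar>L (1 + 1) - \<beta> 1\<bar> + \<alpha> * (\<beta> (1 + 1) - \<beta> 1)"
    using bal n unfolding balanced_borders_def by force
  moreover have "\<beta> 0 = 0" using bal by (simp add: balanced_borders_def)
  ultimately show ?thesis using L1 L2 by (simp add: numeral_2_eq_2)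
qed

lemma borders_le: "\<beta> 1 \<le> \<beta> 2" "0 \<le> \<beta> 1"
proof -
  have "\<forall>i\<in>{1..n}. \<beta> (i - 1) \<le> \<beta> i" "\<beta> 0 = 0"
    using bal unfolding balanced_borders_def by blast+
  then show "\<beta> 1 \<le> \<beta> 2" "0 \<le> \<beta> 1"
    using n bspec[of "{1..n}" "\<lambda>i. \<beta> (i - 1) \<le> \<beta> i" 1] bspec[of "{1..n}" "\<lambda>i. \<beta> (i - 1) \<le> \<beta> i" 2]
    by auto
qed

text \<open>
  Otherwise the first two loads are below \<open>1 / n\<close>, and walking to the right the pair
  borders fall ever further behind their old positions, while the last one is at its old position.
\<close>

lemma first_border_ge:
  assumes "\<alpha> < 1"
  shows "1 / real n \<le> \<beta> 1"
proof (rule ccontr)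
  assume "\<not> 1 / real n \<le> \<beta> 1"
  then have lt: "\<beta> 1 < 1 / real n" by simp
  have b2: "\<beta> 2 - \<beta> 1 = (1 - \<alpha>) * (1 / real n - \<beta> 1) + \<alpha> * \<beta> 1"
    using first_balance lt borders_le by (simp add: algebra_simps diff_divide_distrib)
  have "\<alpha> * \<beta> 1 < \<alpha> * (1 / real n)" using lt \<alpha> by (intro mult_strict_left_mono) auto
  moreover have "(1 - \<alpha>) * (1 / real n - \<beta> 1) \<le> (1 - \<alpha>) * (1 / real n)"
    using borders_le assms by (intro mult_left_mono) auto
  ultimately have l2: "\<beta> 2 - \<beta> 1 < 1 / real n"
    using b2 by (simp add: algebra_simps diff_divide_distrib)
  have d1: "d 1 < 0" using l2 lt unfolding d_one(1) by linarith
  \<comment> \<open>Facility 2 sits at \<open>\<beta> 2\<close>, so her distance cost there is 0,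
    while that of facility 3 is nonnegative; hence facility 3 has at most the load of facility
    2.\<close>
  have "\<bar>3 / real n - \<beta> 2\<bar> \<ge> 0" by simp
  then have "\<alpha> * (d 2 - d 1) / 2 + \<alpha> / real n \<le> \<alpha> * (\<beta> 2 - \<beta> 1)"
    using border_balance[of 1] n L2(1) assms by (simp add: numeral_2_eq_2)
  moreover have "\<alpha> * (\<beta> 2 - \<beta> 1) < \<alpha> / real n"
    using mult_strict_left_mono[OF l2 \<alpha>(1)] by simp
  ultimately have "\<alpha> * (d 2 - d 1) < 0" by linarith
  then have d2: "d 2 < d 1" using \<alpha>(1) by (simp add: mult_less_0_iff)
  \<comment> \<open>Since \<open>d 2 < d 1 < 0\<close> and \<open>d k = 0\<close>, the minimum of
    \<open>d\<close> is negative and interior, which contradicts \<open>d_concave\<close>.\<close>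
  obtain m where m: "m \<in> {1..k}" "\<forall>l\<in>{1..k}. - d l \<le> - d m"
    using ex_argmax_nat[of 1 k "\<lambda>l. - d l"] n by auto
  have "- d 1 \<le> - d m" "- d 2 \<le> - d m" using m(2) n by auto
  then have "d m < 0" "m \<noteq> 1" "m \<noteq> k" using d1 d2 d_last by auto
  then have "m \<in> {1<..<k}" "m - 1 \<in> {1..k}" "m + 1 \<in> {1..k}" using m(1) by auto
  then have "d (m + 1) - d m < d m - d (m - 1)" "d m \<le> d (m - 1)" "d m \<le> d (m + 1)"
    using d_concave[OF assms] \<open>d m < 0\<close> m(2) by auto
  then show False by linarith
qed

text \<open>By \<open>abs_d_le\<close>, or trivially for \<open>\<alpha> = 1\<close>,
  \<open>balanced_inside\<close> applies at these borders.\<close>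

lemma even_border:
  assumes "l \<in> {2..<k}"
  shows "\<beta> (2 * l) = (1 - \<alpha>) * (2 * real l / real n) + \<alpha> / 2 * (\<beta> (2 * l - 1) + \<beta> (2 * l + 1))"
proof -
  have L: "L (2 * l) = (2 * real l - 1) / real n" "L (2 * l + 1) = (2 * real l + 1) / real n"
    using L_even[of l] L_odd[of l] assms by auto
  have "\<alpha> = 1 \<or> L (2 * l) \<le> \<beta> (2 * l) \<and> \<beta> (2 * l) \<le> L (2 * l + 1)"
  proof (cases "\<alpha> = 1")
    case False
    then have "\<bar>d l\<bar> \<le> 1 / real n" using abs_d_le[of l] \<alpha> assms by auto
    then show ?thesis unfolding L d_def by (auto simp: add_divide_distrib diff_divide_distrib)
  qed auto
  then have *: "2 * \<beta> (2 * l) = (1 - \<alpha>) * (L (2 * l) + L (2 * l + 1)) + \<alpha> * (\<beta> (2 * l - 1) + \<beta> (2 * l + 1))"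
    using assms n by (intro balanced_inside[OF bal]) auto
  define c where "c = 2 * real l / real n"
  have c: "L (2 * l) + L (2 * l + 1) = 2 * c"
    unfolding L by (simp add: c_def add_divide_distrib[symmetric])
  show ?thesis using * unfolding c c_def[symmetric] by (simp add: algebra_simps)
qed

lemma deviation_borders: "\<beta> 1 = beta1' n \<alpha>" "\<beta> 2 = beta2' n \<alpha>"
proof -
  have "\<alpha> = 1 \<or> 1 / real n \<le> \<beta> 1" using first_border_ge \<alpha> by linarith
  then have *: "2 * \<beta> 1 = (1 - \<alpha>) * (L 1 + L (1 + 1)) + \<alpha> * (\<beta> (1 - 1) + \<beta> (1 + 1))"
    using n borders_le L1 L2
    by (intro balanced_inside[OF bal]) (auto simp: numeral_2_eq_2)
  have "\<beta> 0 = 0" using bal by (simp add: balanced_borders_def)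
  have one: "\<beta> 1 = (1 - \<alpha>) / (2 * real n) + \<beta> 2 / 2"
  proof -
    define c where "c = 1 / real n"
    have c: "(1 - \<alpha>) / (2 * real n) = (1 - \<alpha>) * c / 2" by (simp add: c_def)
    show ?thesis
      using * \<open>\<beta> 0 = 0\<close> L1 L2(1) unfolding c c_def[symmetric]
      by (simp add: numeral_2_eq_2 algebra_simps diff_divide_distrib)
  qed
  \<comment> \<open>Border 2 coincides with facility 2 and is not beyond facility 3, so
    \<open>balanced_inside\<close> applies for every \<open>\<alpha>\<close>.\<close>
  have "2 * \<beta> 2 = (1 - \<alpha>) * (L 2 + L (2 + 1)) + \<alpha> * (\<beta> (2 - 1) + \<beta> (2 + 1))"
    using n L2 L_odd[of 1] by (intro balanced_inside[OF bal]) auto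
  then have two: "(1 + \<alpha>) * \<beta> 2 = \<alpha> * \<beta> 1 + (1 - \<alpha>) * (3 / real n) + \<alpha> * \<beta> 3"
    using L2(1) L_odd[of 1] n(2) by (simp add: numeral_3_eq_3 algebra_simps diff_divide_distrib)
  have "\<beta> n = 1" using bal by (simp add: balanced_borders_def)
  then show "\<beta> 1 = beta1' n \<alpha>" "\<beta> 2 = beta2' n \<alpha>"
    using border_system_solution[OF \<alpha> n one two odd_border even_border] by auto
qed

end

section \<open>The approximate equilibrium at the paired locations\<close>

lemma pair_locations:
  assumes "n = 2 * k"
    and "\<forall>i\<in>{1..k}. s (2 * i - 1) = (2 * real i - 1) / (2 * real k)
                  \<and> s (2 * i) = (2 * real i - 1) / (2 * real k)"
    and "i \<in> {1..n}"
  shows "s i = (if odd i then real i / real n else (real i - 1) / real n)"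
proof (cases "odd i")
  case True
  then obtain l where l: "i = 2 * l + 1" by (elim oddE)
  then show ?thesis using bspec[OF assms(2), of "l + 1"] assms(1,3) by auto
next
  case False
  then obtain l where l: "i = 2 * l" by (auto elim: evenE)
  then show ?thesis using bspec[OF assms(2), of l] assms(1,3) by auto
qed

theorem theorem6:
  fixes n k :: nat and \<alpha> :: real and s_pair :: "nat \<Rightarrow> real"
  assumes n_even: "n = 2 * k" and n_gt: "n > 3"
    and alpha: "\<alpha> \<in> {0<..1}"
    and s_pair_loc: "s_pair \<in> loc_vectors n"
    and s_pair: "\<forall>i\<in>{1..k}. s_pair (2 * i - 1) = (2 * real i - 1) / (2 * real k)
                          \<and> s_pair (2 * i) = (2 * real i - 1) / (2 * real k)"
    and conjecture:
      "\<exists>x\<in>{0..1}. s_pair 2 < x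
         \<and> (\<exists>\<sigma> \<beta> g. proper_client_equilibrium n \<alpha> (s_pair(2 := x)) \<sigma> \<beta> g \<and> \<sigma> 2 = 2 \<and> x = \<beta> 2)
         \<and> (\<forall>i\<in>{1..n}. \<forall>y\<in>{0..1}.
              induced_utility n \<alpha> (s_pair(i := y)) i / induced_utility n \<alpha> s_pair i
              \<le> induced_utility n \<alpha> (s_pair(2 := x)) 2 / induced_utility n \<alpha> s_pair 2)"
  shows "\<exists>s f. rho_SPE n \<alpha> (real n * (beta2' n \<alpha> - beta1' n \<alpha>)) s f"
proof -
  have \<alpha>: "0 < \<alpha>" "\<alpha> \<le> 1" using alpha by auto
  have n: "n \<ge> 1" "real n > 0" "k \<ge> 2" using n_gt n_even by auto
  note loc = pair_locations[OF n_even s_pair]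
  have sorted: "s_pair i \<le> s_pair (i + 1)" if "i \<in> {1..<n}" for i
    using that loc[of i] loc[of "i + 1"] n by (auto simp: divide_right_mono)
  have upd: "s_pair(i := y) \<in> loc_vectors n" if "i \<in> {1..n}" "y \<in> {0..1}" for i y
    using s_pair_loc that unfolding loc_vectors_def by (auto simp: PiE_iff extensional_def)
  obtain x \<sigma> \<beta> g where x: "x \<in> {0..1}" "s_pair 2 < x"
    and p: "proper_client_equilibrium n \<alpha> (s_pair(2 := x)) \<sigma> \<beta> g" and \<sigma>2: "\<sigma> 2 = 2" and x\<beta>: "x = \<beta> 2"
    and best: "\<And>i y. i \<in> {1..n} \<Longrightarrow> y \<in> {0..1} \<Longrightarrow>
      induced_utility n \<alpha> (s_pair(i := y)) i / induced_utility n \<alpha> s_pair i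
        \<le> induced_utility n \<alpha> (s_pair(2 := x)) 2 / induced_utility n \<alpha> s_pair 2"
    using conjecture by blast
  define t where "t = s_pair(2 := x)"
  have t: "t \<in> loc_vectors n" unfolding t_def using upd[of 2 x] x(1) n_gt by simp

  \<comment> \<open>Before any deviation, border \<open>i / n\<close> is the common location of a
    pair for odd \<open>i\<close> and midway between two pairs for even \<open>i\<close>; all loads
    are \<open>1 / n\<close>.\<close>
  have bal_pair: "balanced_borders n \<alpha> s_pair (\<lambda>i. real i / real n)"
    unfolding balanced_borders_def
  proof (intro conjI ballI)
    fix i assume i: "i \<in> {1..<n}"
    have "\<bar>s_pair i - real i / real n\<bar> = \<bar>s_pair (i + 1) - real i / real n\<bar>"
      using loc[of i] loc[of "i + 1"] i n by (auto simp: diff_divide_distrib add_divide_distrib)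
    then show "(1 - \<alpha>) * \<bar>s_pair i - real i / real n\<bar> + \<alpha> * (real i / real n - real (i - 1) / real n)
        = (1 - \<alpha>) * \<bar>s_pair (i + 1) - real i / real n\<bar> + \<alpha> * (real (i + 1) / real n - real i / real n)"
      using i by (simp add: of_nat_diff diff_divide_distrib add_divide_distrib)
  qed (use n in \<open>auto simp: divide_right_mono\<close>)
  have u_pair: "induced_utility n \<alpha> s_pair i = 1 / real n" if "i \<in> {1..n}" for i
    using induced_utility_balanced[OF n(1) \<alpha> sorted bal_pair that] that
    by (simp add: of_nat_diff diff_divide_distrib)

  have \<sigma>: "\<sigma> permutes {1..n}" and \<sigma>_sorted: "\<And>i. i \<in> {1..<n} \<Longrightarrow> t (\<sigma> i) \<le> t (\<sigma> (i + 1))"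
    using p unfolding proper_client_equilibrium_def t_def by auto
  \<comment> \<open>With \<open>\<sigma> 2 = 2\<close>, every facility ranked second or later is at
    \<open>x\<close> or further right. Facility 1 is left of \<open>x\<close> and must be ranked
    first, so facility 3 is ranked later and forces \<open>x \<le> 3 / n\<close>.\<close>
  have after2: "x \<le> t (\<sigma> i)" if "2 \<le> i" "i \<le> n" for i
    using that
  proof (induction i rule: dec_induct)
    case base
    then show ?case by (simp add: \<sigma>2 t_def)
  next
    case (step i)
    then show ?case using \<sigma>_sorted[of i] by auto
  qed
  have pos: "\<exists>i\<in>{1..n}. \<sigma> i = j" if "j \<in> {1..n}" for j
    using that permutes_image[OF \<sigma>] by (metis imageE)
  have t1: "t 1 = 1 / real n" "s_pair 2 = 1 / real n" "t 3 = 3 / real n"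
    using loc[of 1] loc[of 2] loc[of 3] n_gt by (auto simp: t_def)
  have \<sigma>1: "\<sigma> 1 = 1"
  proof -
    have "1 \<in> {1..n}" using n_gt by simp
    then obtain i where i: "i \<in> {1..n}" "\<sigma> i = 1" using pos by blast
    then have "\<not> 2 \<le> i" using after2[of i] t1 x(2) by auto
    then show ?thesis using i by (cases "i = 1") auto
  qed
  have x3: "x \<le> 3 / real n"
  proof -
    have "3 \<in> {1..n}" using n_gt by simp
    then obtain i where i: "i \<in> {1..n}" "\<sigma> i = 3" using pos by blast
    then have "i \<noteq> 1" using \<sigma>1 by auto
    then show ?thesis using after2[of i] i t1 by auto
  qed

  have t_sorted: "t i \<le> t (i + 1)" if "i \<in> {1..<n}" for i
  proof -
    have "1 \<le> i" using that by simp
    then consider "i = 1" | "i = 2" | "i \<ge> 3" by linarith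
    then show ?thesis
    proof cases
      case 1
      then show ?thesis using x(2) t1 by (simp add: t_def)
    next
      case 2
      then show ?thesis using x3 t1 by (simp add: t_def)
    next
      case 3
      then show ?thesis using sorted[OF that] by (simp add: t_def)
    qed
  qed
  have "t i \<in> {0..1}" if "i \<in> {1..n}" for i
    using t that by (auto simp: loc_vectors_def PiE_iff)
  then obtain \<gamma> where \<gamma>: "balanced_borders n \<alpha> t \<gamma>"
    using ex_balanced_borders[of n \<alpha> t, OF n(1) \<alpha> _ t_sorted] by blast
  have u_dev: "induced_utility n \<alpha> t i = \<gamma> i - \<gamma> (i - 1)" if "i \<in> {1..n}" for i
    using induced_utility_balanced[of n \<alpha> t \<gamma> i, OF n(1) \<alpha> t_sorted \<gamma> that] .
  \<comment> \<open>By uniqueness of the loads the balanced borders agree with the given ones.\<close>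
  have "\<gamma> 2 = x"
  proof -
    have r: "1 \<in> {1..n}" "2 \<in> {1..n}" using n_gt by auto
    have "\<gamma> 1 - \<gamma> 0 = \<beta> 1 - \<beta> 0"
      using u_dev[OF r(1)] proper_load[OF p r(1)] induced_utility_eq[OF \<alpha>(1) r(1) p] \<sigma>1
      by (simp add: t_def)
    moreover have "\<gamma> 2 - \<gamma> 1 = \<beta> 2 - \<beta> 1"
      using u_dev[OF r(2)] proper_load[OF p r(2)] induced_utility_eq[OF \<alpha>(1) r(2) p] \<sigma>2
      by (simp add: t_def)
    moreover have "\<gamma> 0 = 0" "\<beta> 0 = 0"
      using \<gamma> p by (auto simp: balanced_borders_def proper_client_equilibrium_def)
    ultimately show ?thesis using x\<beta> by simp
  qed
  interpret dev: pair_deviation n k \<alpha> t \<gamma>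
  proof
    show "t (2 * l + 1) = (2 * real l + 1) / real n" if "l \<in> {1..<k}" for l
      using loc[of "2 * l + 1"] that n_even by (auto simp: t_def)
    show "t (2 * l) = (2 * real l - 1) / real n" if "l \<in> {2..k}" for l
      using loc[of "2 * l"] that n_even by (auto simp: t_def)
  qed (use \<alpha> n_even n t1 x x3 \<gamma> \<open>\<gamma> 2 = x\<close> in \<open>auto simp: t_def\<close>)
  define \<rho> where "\<rho> = real n * (beta2' n \<alpha> - beta1' n \<alpha>)"
  \<comment> \<open>Loads before the move are \<open>1 / n\<close>, so the improvement factor is
    \<open>n\<close> times the new load of facility 2, the difference of her borders.\<close>
  have \<rho>: "induced_utility n \<alpha> (s_pair(2 := x)) 2 / induced_utility n \<alpha> s_pair 2 = \<rho>"
    using u_dev[of 2] u_pair[of 2] n_gt dev.deviation_borders by (simp add: t_def \<rho>_def)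

  \<comment> \<open>Choosing one such equilibrium for every location vector yields a client mapping
    whose utilities are the induced ones, so the hypothesis on induced utilities bounds all
    deviations.\<close>
  have "\<forall>t\<in>loc_vectors n. \<exists>g. client_assignment n g \<and> client_equilibrium n \<alpha> t g
      \<and> (\<forall>i\<in>{1..n}. load g i = induced_utility n \<alpha> t i)"
  proof
    fix t assume "t \<in> loc_vectors n"
    then obtain \<sigma> \<beta> g where "proper_client_equilibrium n \<alpha> t \<sigma> \<beta> g"
      using ex_proper_client_equilibrium[OF n(1) \<alpha>] by blast
    then show "\<exists>g. client_assignment n g \<and> client_equilibrium n \<alpha> t g
      \<and> (\<forall>i\<in>{1..n}. load g i = induced_utility n \<alpha> t i)"
      using induced_utility_eq[OF \<alpha>(1)] unfolding proper_client_equilibrium_def by metis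
  qed
  then obtain f where f: "\<forall>t\<in>loc_vectors n. client_assignment n (f t) \<and> client_equilibrium n \<alpha> t (f t)
      \<and> (\<forall>i\<in>{1..n}. load (f t) i = induced_utility n \<alpha> t i)"
    by metis
  have "rho_SPE n \<alpha> \<rho> s_pair f"
    unfolding rho_SPE_def
  proof (intro conjI ballI)
    fix i y assume i: "i \<in> {1..n}" and y: "y \<in> {0..1::real}"
    have "induced_utility n \<alpha> (s_pair(i := y)) i \<le> \<rho> * induced_utility n \<alpha> s_pair i"
      using best[OF i y] n unfolding \<rho> u_pair[OF i] by (simp add: field_simps)
    then show "utility f (s_pair(i := y)) i \<le> \<rho> * utility f s_pair i"
      using f s_pair_loc upd[OF i y] i by (simp add: utility_def)
  qed (use f s_pair_loc in \<open>auto simp: client_mapping_def\<close>)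
  then show ?thesis unfolding \<rho>_def by blast
qed

end
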